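(* Let $d, m \in \mathbb{N}$ and let $A \subseteq \mathbb{R}^d$ be given by $$A=\{x \in \mathbb{R}^d : \Phi\bigl((p_1(x)\ge 0),\ldots,(p_m(x)\ge 0)\bigr)\},$$ where $\Phi$ is a boolean formula in $m$ boolean arguments and $p_1,\ldots,p_m \in \mathbb{R}[x]\setminus\{0\}$. Let $f\in\mathbb{R}[x]$ be a polynomial irreducible over $\mathbb{R}[x]$. Then the following statements hold. (I) If there exist $b \in Z(f)$ and $\varepsilon>0$ such that $\dim(Z(f)\cap B^d(b,\varepsilon)) = d-1$ and $Z(f)\cap B^d(b,\varepsilon) = A\cap B^d(b,\varepsilon)$, then $\dim(\operatorname{bd} A\cap Z(f)) = d-1$, and furthermore $f$ is a factor of both $p_i$ and $p_j$ for some $i,j\in\{1,\ldots,m\}$ with $i\ne j$, or $f$ is an even-multiplicity factor of $p_i$ for some $i\in\{1,\ldots,m\}$. (II) If there exist $a,b\in\mathbb{R}^d$ and $\varepsilon>0$ such that $$\dim(Z(f)\cap B^d(a,\varepsilon)) = d-1,\qquad (f)_{\ge 0}\cap B^d(a,\varepsilon)=A\cap B^d(a,\varepsilon),$$ $$\dim(Z(f)\cap B^d(b,\varepsilon)) = d-1,\qquad Z(f)\cap B^d(b,\varepsilon)=A\cap B^d(b,\varepsilon),$$ then $f$ is a factor of $p_i$ and an odd-multiplicity factor of $p_j$ for some $i,j\in\{1,\ldots,m\}$ with $i\neq j$.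
   Context: $\mathbb{R}[x]=\mathbb{R}[x_1,\ldots,x_d]$ is the ring of real polynomials in $d$ variables. For $f \in \mathbb{R}[x]$: $Z(f)=\{x\in\mathbb{R}^d: f(x)=0\}$, $(f)_{\ge 0}=\{x \in \mathbb{R}^d: f(x)\ge 0\}$. $B^d(c,\rho)$ is the open Euclidean ball in $\mathbb{R}^d$ with center $c$ and radius $\rho$; $\operatorname{bd}$ denotes the topological boundary in $\mathbb{R}^d$. The dimension $\dim S$ of a semi-algebraic set $S\subseteq\mathbb{R}^d$ is the Krull dimension of the ring $\mathbb{R}[x]/\mathcal{I}(S)$, where $\mathcal{I}(S)=\{p\in\mathbb{R}[x]: p(x)=0 \text{ for all } x\in S\}$ (the usual semi-algebraic dimension, with the zero ring, i.e. $S=\emptyset$, having negative dimension). A polynomial is irreducible over $\mathbb{R}[x]$ if it is non-constant and is not a product of two non-constant polynomials in $\mathbb{R}[x]$. $p$ is a factor of $q$ if $q=pg$ for some $g\in\mathbb{R}[x]$. An irreducible factor $f$ of $p$ has multiplicity $k\in\mathbb{N}$ ($k\ge 1$) if $f^k$ is a factor of $p$ but $f^{k+1}$ is not; it is an odd- (even-) multiplicity factor if $k$ is odd (even). *)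

theory Defs
  imports
    "HOL-Analysis.Analysis"
    "HOL-Library.Poly_Mapping"
    "HOL-Computational_Algebra.Computational_Algebra"
    "HOL-Algebra.Algebraic_Closure_Type"
begin

section \<open>Real polynomials in several variables\<close>

text \<open>
  The variables are indexed by a finite type, so that the number \<open>d\<close> of variables is its
  cardinality. A polynomial maps each monomial, given by its exponents, to its coefficient, and the
  ring structure is the one of \<^theory>\<open>HOL-Library.Poly_Mapping\<close>.
\<close>

type_synonym 'n rpoly = "('n \<Rightarrow>\<^sub>0 nat) \<Rightarrow>\<^sub>0 real"

definition poly_eval :: "'n::finite rpoly \<Rightarrow> real ^ 'n \<Rightarrow> real" where
  "poly_eval p x =
    (\<Sum>m\<in>Poly_Mapping.keys p. Poly_Mapping.lookup p m * (\<Prod>i\<in>UNIV. x $ i ^ Poly_Mapping.lookup m i))"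

definition zero_set :: "'n::finite rpoly \<Rightarrow> (real ^ 'n) set" where
  "zero_set f = {x. poly_eval f x = 0}"

definition nonneg_set :: "'n::finite rpoly \<Rightarrow> (real ^ 'n) set" where
  "nonneg_set f = {x. poly_eval f x \<ge> 0}"

abbreviation irreducible_poly :: "'n::finite rpoly \<Rightarrow> bool" where
  "irreducible_poly \<equiv> comm_semiring_1_class.irreducible"

definition constant_poly :: "'n rpoly \<Rightarrow> bool" where
  "constant_poly p \<longleftrightarrow> (\<exists>c. p = Poly_Mapping.single 0 c)"

definition has_multiplicity :: "'n rpoly \<Rightarrow> 'n rpoly \<Rightarrow> nat \<Rightarrow> bool" where
  "has_multiplicity f p k \<longleftrightarrow> k \<ge> 1 \<and> f ^ k dvd p \<and> \<not> f ^ (k + 1) dvd p"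

definition odd_multiplicity_factor :: "'n rpoly \<Rightarrow> 'n rpoly \<Rightarrow> bool" where
  "odd_multiplicity_factor f p \<longleftrightarrow> (\<exists>k. has_multiplicity f p k \<and> odd k)"

definition even_multiplicity_factor :: "'n rpoly \<Rightarrow> 'n rpoly \<Rightarrow> bool" where
  "even_multiplicity_factor f p \<longleftrightarrow> (\<exists>k. has_multiplicity f p k \<and> even k)"

section \<open>Dimension\<close>

text \<open>
  The value is an extended real, so that a ring without prime ideals, i.e. the zero ring, has Krull
  dimension \<open>Sup {} = -\<infinity>\<close>.
\<close>

definition krull_dim :: "('a, 'b) ring_scheme \<Rightarrow> ereal" where
  "krull_dim R = Sup {ereal (real n) | n.
     \<exists>P. (\<forall>i\<le>n. primeideal (P i) R) \<and> (\<forall>i<n. P i \<subset> P (Suc i))}"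

definition vanishing_ideal :: "(real ^ 'n::finite) set \<Rightarrow> 'n rpoly set" where
  "vanishing_ideal S = {p. \<forall>x\<in>S. poly_eval p x = 0}"

definition semialg_dim :: "(real ^ 'n::finite) set \<Rightarrow> ereal" where
  "semialg_dim S = krull_dim ((ring_of_type_algebra :: 'n rpoly ring) Quot vanishing_ideal S)"

section \<open>Boolean formulas\<close>

datatype bool_formula =
    BTrue
  | BFalse
  | BVar nat
  | BNot bool_formula
  | BAnd bool_formula bool_formula
  | BOr bool_formula bool_formula

primrec bool_vars :: "bool_formula \<Rightarrow> nat set" where
  "bool_vars BTrue = {}"
| "bool_vars BFalse = {}"
| "bool_vars (BVar i) = {i}"
| "bool_vars (BNot F) = bool_vars F"
| "bool_vars (BAnd F G) = bool_vars F \<union> bool_vars G"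
| "bool_vars (BOr F G) = bool_vars F \<union> bool_vars G"

primrec bool_eval :: "bool_formula \<Rightarrow> (nat \<Rightarrow> bool) \<Rightarrow> bool" where
  "bool_eval BTrue v \<longleftrightarrow> True"
| "bool_eval BFalse v \<longleftrightarrow> False"
| "bool_eval (BVar i) v \<longleftrightarrow> v i"
| "bool_eval (BNot F) v \<longleftrightarrow> \<not> bool_eval F v"
| "bool_eval (BAnd F G) v \<longleftrightarrow> bool_eval F v \<and> bool_eval G v"
| "bool_eval (BOr F G) v \<longleftrightarrow> bool_eval F v \<or> bool_eval G v"

section \<open>Evaluation is a ring homomorphism\<close>

definition subst_monomials ::
    "('a::comm_semiring_1 \<Rightarrow> 'b::comm_semiring_1) \<Rightarrow> ('m \<Rightarrow> 'b) \<Rightarrow> ('m \<Rightarrow>\<^sub>0 'a) \<Rightarrow> 'b" where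
  "subst_monomials c g p =
    (\<Sum>m\<in>Poly_Mapping.keys p. c (Poly_Mapping.lookup p m) * g m)"

lemma subst_monomials_superset:
  assumes "c 0 = 0" "finite S" "Poly_Mapping.keys p \<subseteq> S"
  shows "subst_monomials c g p = (\<Sum>m\<in>S. c (Poly_Mapping.lookup p m) * g m)"
  unfolding subst_monomials_def
  by (rule sum.mono_neutral_left) (use assms in \<open>auto simp: in_keys_iff\<close>)

lemma subst_monomials_add:
  assumes "c 0 = 0" "\<And>a b. c (a + b) = c a + c b"
  shows "subst_monomials c g (p + q) = subst_monomials c g p + subst_monomials c g q"
proof -
  let ?S = "Poly_Mapping.keys p \<union> Poly_Mapping.keys q"
  have "Poly_Mapping.keys (p + q) \<subseteq> ?S" by (rule keys_add)
  then show ?thesis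
    using subst_monomials_superset[of c ?S _ g] assms
    by (simp add: lookup_add sum.distrib distrib_right)
qed

lemma subst_monomials_single:
  assumes "c 0 = 0"
  shows "subst_monomials c g (Poly_Mapping.single m a) = c a * g m"
  using subst_monomials_superset[of c "{m}" "Poly_Mapping.single m a" g] assms by simp

lemma poly_mapping_expand:
  "p = (\<Sum>m\<in>Poly_Mapping.keys p. Poly_Mapping.single m (Poly_Mapping.lookup p m))"
  by (rule poly_mapping_eqI)
    (auto simp: lookup_sum lookup_single when_def in_keys_iff intro!: sum.neutral)

lemma subst_monomials_sum:
  assumes "c 0 = 0" "\<And>a b. c (a + b) = c a + c b"
  shows "subst_monomials c g (sum F S) = (\<Sum>s\<in>S. subst_monomials c g (F s))"
  by (induction S rule: infinite_finite_induct)
    (simp_all add: subst_monomials_add assms, simp_all add: subst_monomials_def)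

lemma subst_monomials_mult:
  fixes g :: "'m::comm_monoid_add \<Rightarrow> 'b::comm_semiring_1"
  assumes c: "c 0 = 0" "\<And>a b. c (a + b) = c a + c b" "\<And>a b. c (a * b) = c a * c b"
    and g: "\<And>m n. g (m + n) = g m * g n"
  shows "subst_monomials c g (p * q) = subst_monomials c g p * subst_monomials c g q"
proof -
  let ?P = "\<lambda>p m. Poly_Mapping.single m (Poly_Mapping.lookup p m)"
  have "p * q = (\<Sum>m\<in>Poly_Mapping.keys p. ?P p m) * (\<Sum>n\<in>Poly_Mapping.keys q. ?P q n)"
    using poly_mapping_expand[of p] poly_mapping_expand[of q] by simp
  then have "p * q = (\<Sum>m\<in>Poly_Mapping.keys p. \<Sum>n\<in>Poly_Mapping.keys q. ?P p m * ?P q n)"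
    by (simp add: sum_product)
  then have "subst_monomials c g (p * q) = (\<Sum>m\<in>Poly_Mapping.keys p. \<Sum>n\<in>Poly_Mapping.keys q.
      (c (Poly_Mapping.lookup p m) * g m) * (c (Poly_Mapping.lookup q n) * g n))"
    by (simp add: subst_monomials_sum c mult_single subst_monomials_single g mult_ac)
  then show ?thesis by (simp add: subst_monomials_def sum_product)
qed

lemma poly_eval_alt:
  "poly_eval p x = subst_monomials (\<lambda>a. a) (\<lambda>m. \<Prod>i\<in>UNIV. x $ i ^ Poly_Mapping.lookup m i) p"
  by (simp add: poly_eval_def subst_monomials_def)

lemma poly_eval_add: "poly_eval (p + q) x = poly_eval p x + poly_eval q x"
  by (simp add: poly_eval_alt subst_monomials_add)

lemma poly_eval_mult: "poly_eval (p * q) x = poly_eval p x * poly_eval q x"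
  unfolding poly_eval_alt
  by (rule subst_monomials_mult) (simp_all add: lookup_add power_add prod.distrib)

lemma poly_eval_single:
  "poly_eval (Poly_Mapping.single m a) x = a * (\<Prod>i\<in>UNIV. x $ i ^ Poly_Mapping.lookup m i)"
  by (simp add: poly_eval_alt subst_monomials_single)

section \<open>Irreducibility\<close>

text \<open>
  The units of the polynomial ring are the nonzero constants, so irreducibility in the sense of the
  library says that a polynomial is non-constant and not a product of two non-constant ones. The
  degree in one variable is read off after passing to polynomials in that variable over a
  polynomial ring whose variables are linearly ordered, which is an integral domain.
\<close>

lemma dvd_1_imp_constant_poly:
  fixes p :: "'n::finite rpoly"
  assumes "p dvd 1"
  shows "constant_poly p"
proof (rule ccontr)
  assume nc: "\<not> constant_poly p"
  obtain q where q: "1 = p * q" using assms by (auto elim: dvdE)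
  have "\<exists>m\<in>Poly_Mapping.keys p. m \<noteq> 0"
  proof (rule ccontr)
    assume "\<not> ?thesis"
    then have "p = Poly_Mapping.single 0 (Poly_Mapping.lookup p 0)"
      by (intro poly_mapping_eqI) (auto simp: lookup_single when_def in_keys_iff)
    with nc show False unfolding constant_poly_def by blast
  qed
  then obtain m where m: "m \<in> Poly_Mapping.keys p" "m \<noteq> 0" by blast
  then obtain i where i: "Poly_Mapping.lookup m i \<noteq> 0"
    by (metis lookup_zero poly_mapping_eqI)
  obtain e :: "'n \<Rightarrow> nat" where e: "inj e"
    using finite_imp_inj_to_nat_seg[of "UNIV :: 'n set"] by auto
  define r :: "('n \<Rightarrow>\<^sub>0 nat) \<Rightarrow> (nat \<Rightarrow>\<^sub>0 nat)"
    where "r m = (\<Sum>j\<in>UNIV. Poly_Mapping.single (e j) (Poly_Mapping.lookup m j))" for m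
  have r_add: "r (m + n) = r m + r n" for m n
    by (simp add: r_def lookup_add single_add sum.distrib)
  have "Poly_Mapping.lookup (r m) (e j) = Poly_Mapping.lookup m j" for m j
    using e by (simp add: r_def lookup_sum lookup_single when_def inj_eq)
  then have r_inj: "r m = r n \<longleftrightarrow> m = n" for m n
    by (metis poly_mapping_eqI)
  have r_0: "r 0 = 0" by (simp add: r_def)
  define c :: "real \<Rightarrow> ((nat \<Rightarrow>\<^sub>0 nat) \<Rightarrow>\<^sub>0 real) poly"
    where "c a = [:Poly_Mapping.single 0 a:]" for a
  define g :: "('n \<Rightarrow>\<^sub>0 nat) \<Rightarrow> ((nat \<Rightarrow>\<^sub>0 nat) \<Rightarrow>\<^sub>0 real) poly"
    where "g m = Polynomial.monom (Poly_Mapping.single (r m) 1) (Poly_Mapping.lookup m i)" for m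
  let ?E = "subst_monomials c g"
  have c: "c 0 = 0" "c (a + b) = c a + c b" "c (a * b) = c a * c b" for a b
    by (simp_all add: c_def single_add mult_single mult.commute)
  have g: "g (m + n) = g m * g n" for m n
    by (simp add: g_def r_add lookup_add Polynomial.mult_monom mult_single)
  have "?E 1 = ?E (Poly_Mapping.single 0 1)" by (simp only: single_one)
  also have "\<dots> = c 1 * g 0" by (rule subst_monomials_single) (rule c)
  also have "\<dots> = 1" by (simp add: c_def g_def r_0 monom_0 one_pCons)
  finally have E1: "?E p * ?E q = 1"
    using subst_monomials_mult[of c g p q] c g q by simp
  have "?E p \<noteq> 0" "?E q \<noteq> 0" using E1 by auto
  then have "Polynomial.degree (?E p) + Polynomial.degree (?E q) = 0"
    using arg_cong[OF E1, of Polynomial.degree] by (simp add: Polynomial.degree_mult_eq)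
  then have 0: "poly.coeff (?E p) (Poly_Mapping.lookup m i) = 0"
    using i by (intro coeff_eq_0) simp
  have "Poly_Mapping.lookup (poly.coeff (?E p) (Poly_Mapping.lookup m i)) (r m)
      = (\<Sum>n\<in>Poly_Mapping.keys p. if n = m then Poly_Mapping.lookup p n else 0)"
    unfolding subst_monomials_def coeff_sum lookup_sum
    by (rule sum.cong)
      (auto simp: c_def g_def mult_single lookup_single when_def r_inj)
  also have "\<dots> = Poly_Mapping.lookup p m" using m by simp
  finally show False using 0 m by (simp add: in_keys_iff)
qed

lemma dvd_1_iff_constant_poly:
  fixes p :: "'n::finite rpoly"
  shows "p dvd 1 \<longleftrightarrow> constant_poly p \<and> p \<noteq> 0"
proof
  assume "p dvd 1"
  then show "constant_poly p \<and> p \<noteq> 0" using dvd_1_imp_constant_poly by auto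
next
  assume "constant_poly p \<and> p \<noteq> 0"
  then obtain a where a: "p = Poly_Mapping.single 0 a" "a \<noteq> 0"
    unfolding constant_poly_def by (metis single_zero)
  then have "1 = p * Poly_Mapping.single 0 (inverse a)" by (simp add: mult_single)
  then show "p dvd 1" by (rule dvdI)
qed

lemma irreducible_poly_iff:
  fixes p :: "'n::finite rpoly"
  shows "irreducible_poly p \<longleftrightarrow>
    \<not> constant_poly p \<and> \<not> (\<exists>g h. \<not> constant_poly g \<and> \<not> constant_poly h \<and> p = g * h)"
proof -
  have "constant_poly (0 :: 'n rpoly)"
    unfolding constant_poly_def by (metis single_zero)
  then show ?thesis
    unfolding comm_semiring_1_class.irreducible_def dvd_1_iff_constant_poly by auto
qed

end

theory Submission
  imports Defs
begin

text \<open>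
  Write \<open>d\<close> for the number of variables. Everything rests on one algebraic fact: if \<open>f\<close> is
  irreducible and \<open>S\<close> is a subset of its zero set of dimension \<open>d - 1\<close>, then every polynomial
  vanishing on \<open>S\<close> is a multiple of \<open>f\<close> (lemma \<open>irreducible_divides_vanishing\<close>). Indeed, if
  \<open>g\<close> vanished on \<open>S\<close> without being a multiple of \<open>f\<close>, then a chain of primes over the vanishing
  ideal of \<open>S\<close> could be extended downwards by \<open>(f)\<close> and \<open>(0)\<close>. But chains of primes in the polynomial
  ring have length at most \<open>d\<close> (\<open>prime_chain_length\<close>), so the dimension of \<open>S\<close> would be at most
  \<open>d - 2\<close>. That \<open>(f)\<close> is prime is Gauss's theorem (\<open>irreducible_rpoly_imp_prime\<close>).

  The fact has two uses. First, \<open>S\<close> and any larger subset of the zero set have the same vanishing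
  ideal \<open>(f)\<close>, and therefore the same dimension. In the situation of (I), the set where \<open>f\<close> vanishes in
  the ball lies in the boundary of \<open>A\<close>, because the zero set of \<open>f\<close> has no interior; this gives the
  dimension of the boundary part. Second, finitely many polynomials that are not multiples of \<open>f\<close>
  are simultaneously nonzero at some point \<open>x\<close> of \<open>S\<close>. Write \<open>p\<^sub>i = f ^ k\<^sub>i * g\<^sub>i\<close> with \<open>g\<^sub>i\<close> not a
  multiple of \<open>f\<close>, and take for these polynomials the \<open>g\<^sub>i\<close> together with a partial derivative of \<open>f\<close>
  that is not a multiple of \<open>f\<close>. Near \<open>x\<close> the signs of the \<open>g\<^sub>i\<close> are constant while \<open>f\<close> takes both
  signs (\<open>crossing_at_generic_point\<close>), so the truth values of \<open>p\<^sub>i \<ge> 0\<close> are known there: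

  \<^item> If \<open>k\<^sub>j\<close> is odd for some \<open>j\<close> and all other exponents vanish, or if all exponents vanish, then on
    one side of the zero set all the conditions \<open>p\<^sub>i \<ge> 0\<close> have the same truth value as at \<open>x\<close>. So \<open>A\<close>
    cannot coincide with the zero set of \<open>f\<close> near \<open>x\<close> (\<open>zero_set_not_cut_by_odd_factor\<close>).
  \<^item> If all exponents are even, then each condition \<open>p\<^sub>i \<ge> 0\<close> has the same truth value on both sides of
    the zero set. So \<open>A\<close> cannot coincide with the set \<open>f \<ge> 0\<close> near \<open>x\<close>
    (\<open>nonneg_set_needs_odd_factor\<close>).

  The first observation gives the alternative in (I). For (II), the second one yields an odd exponent
  \<open>k\<^sub>j\<close>, and then the first one, applied at the other ball, yields another nonzero exponent.
\<close>

section \<open>Polynomials as univariate polynomials in one variable\<close>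

definition rvar :: "'n \<Rightarrow> 'n rpoly" where
  "rvar i = Poly_Mapping.single (Poly_Mapping.single i 1) 1"

definition vars :: "'n rpoly \<Rightarrow> 'n set" where
  "vars p = (\<Union>m\<in>Poly_Mapping.keys p. Poly_Mapping.keys m)"

text \<open>
  The polynomial \<open>p\<close> regarded as a univariate polynomial in the variable \<open>i\<close>. The coefficients stay
  in the same type and are free of \<open>i\<close>, so one type serves for all variables; substituting \<open>rvar i\<close>
  for the indeterminate gives back \<open>p\<close>.
\<close>

definition as_poly_in :: "'n \<Rightarrow> 'n rpoly \<Rightarrow> 'n rpoly poly" where
  "as_poly_in i = subst_monomials (\<lambda>a. [:Poly_Mapping.single 0 a:])
     (\<lambda>m. Polynomial.monom (Poly_Mapping.single (Poly_Mapping.update i 0 m) 1) (Poly_Mapping.lookup m i))"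

lemma as_poly_in_add: "as_poly_in i (p + q) = as_poly_in i p + as_poly_in i q"
  unfolding as_poly_in_def by (rule subst_monomials_add) (simp_all add: single_add)

lemma as_poly_in_mult: "as_poly_in i (p * q) = as_poly_in i p * as_poly_in i q"
  unfolding as_poly_in_def
proof (rule subst_monomials_mult)
  fix m n :: "'a \<Rightarrow>\<^sub>0 nat"
  have "Poly_Mapping.update i 0 (m + n) = Poly_Mapping.update i 0 m + Poly_Mapping.update i 0 n"
    by (rule poly_mapping_eqI) (simp add: lookup_update lookup_add)
  then show "Polynomial.monom (Poly_Mapping.single (Poly_Mapping.update i 0 (m + n)) (1::real)) (Poly_Mapping.lookup (m + n) i) =
    Polynomial.monom (Poly_Mapping.single (Poly_Mapping.update i 0 m) 1) (Poly_Mapping.lookup m i) *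
    Polynomial.monom (Poly_Mapping.single (Poly_Mapping.update i 0 n) 1) (Poly_Mapping.lookup n i)"
    by (simp add: lookup_add Polynomial.mult_monom mult_single)
qed (simp_all add: single_add mult_single mult.commute)

lemma as_poly_in_single:
  "as_poly_in i (Poly_Mapping.single m a) =
    Polynomial.monom (Poly_Mapping.single (Poly_Mapping.update i 0 m) a) (Poly_Mapping.lookup m i)"
  by (simp add: as_poly_in_def subst_monomials_single mult_single Polynomial.smult_monom)

lemma as_poly_in_0 [simp]: "as_poly_in i 0 = 0"
  by (simp add: as_poly_in_def subst_monomials_def)

lemma update_0_zero: "Poly_Mapping.update i 0 (0 :: 'a \<Rightarrow>\<^sub>0 nat) = 0"
  by (rule poly_mapping_eqI) (simp add: lookup_update)

lemma as_poly_in_1 [simp]: "as_poly_in i 1 = 1"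
proof -
  have "as_poly_in i 1 = as_poly_in i (Poly_Mapping.single 0 1)" by simp
  also have "\<dots> = 1" unfolding as_poly_in_single by (simp add: update_0_zero monom_0 one_pCons)
  finally show ?thesis .
qed

lemma as_poly_in_rvar [simp]: "as_poly_in i (rvar i) = Polynomial.monom 1 1"
proof -
  have "Poly_Mapping.update i 0 (Poly_Mapping.single i (1::nat)) = 0"
    by (rule poly_mapping_eqI) (simp add: lookup_update lookup_single when_def)
  then show ?thesis by (simp add: rvar_def as_poly_in_single)
qed

lemma as_poly_in_sum: "as_poly_in i (sum F S) = (\<Sum>s\<in>S. as_poly_in i (F s))"
  by (induction S rule: infinite_finite_induct) (simp_all add: as_poly_in_add)

lemma as_poly_in_diff: "as_poly_in i (p - q) = as_poly_in i p - as_poly_in i q"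
  using as_poly_in_add[of i "p - q" q] by (simp add: algebra_simps)

lemma as_poly_in_power: "as_poly_in i (p ^ k) = as_poly_in i p ^ k"
  by (induction k) (simp_all add: as_poly_in_mult)

lemma poly_subst_monomials:
  "poly (subst_monomials c g p) x = subst_monomials (\<lambda>a. poly (c a) x) (\<lambda>m. poly (g m) x) p"
  by (simp add: subst_monomials_def poly_sum)

lemma poly_as_poly_in_rvar: "poly (as_poly_in i p) (rvar i) = p"
proof -
  have rvar_power: "rvar i ^ k = Poly_Mapping.single (Poly_Mapping.single i k) 1" for k
    by (induction k) (simp_all add: rvar_def mult_single single_add[symmetric])
  have "Poly_Mapping.update i 0 m + Poly_Mapping.single i (Poly_Mapping.lookup m i) = m"
    for m :: "'a \<Rightarrow>\<^sub>0 nat"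
    by (rule poly_mapping_eqI) (auto simp: lookup_update lookup_add lookup_single when_def)
  then have "poly (as_poly_in i p) (rvar i)
      = subst_monomials (Poly_Mapping.single 0) (\<lambda>m. Poly_Mapping.single m 1) p"
    by (simp add: as_poly_in_def poly_subst_monomials poly_monom rvar_power mult_single)
  also have "\<dots> = p"
    unfolding subst_monomials_def using poly_mapping_expand[of p] by (simp add: mult_single)
  finally show ?thesis .
qed

lemma as_poly_in_eq_0_iff: "as_poly_in i p = 0 \<longleftrightarrow> p = 0"
  using poly_as_poly_in_rvar[of i p] by auto

text \<open>
  A monomial free of \<open>i\<close> in the coefficient of degree \<open>k\<close> comes from exactly one monomial of \<open>p\<close>,
  which is obtained by adding \<open>k\<close> to the exponent of \<open>i\<close>.
\<close>

lemma lookup_coeff_as_poly_in: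
  "Poly_Mapping.lookup (poly.coeff (as_poly_in i p) k) m =
    (if Poly_Mapping.lookup m i = 0 then Poly_Mapping.lookup p (m + Poly_Mapping.single i k) else 0)"
proof -
  have *: "Poly_Mapping.lookup n i = k \<and> Poly_Mapping.update i 0 n = m \<longleftrightarrow>
     Poly_Mapping.lookup m i = 0 \<and> n = m + Poly_Mapping.single i k" for n
    by (auto simp: poly_mapping_eq_iff fun_eq_iff lookup_update lookup_add lookup_single when_def)
  have "Poly_Mapping.lookup (poly.coeff (as_poly_in i p) k) m =
    (\<Sum>n\<in>Poly_Mapping.keys p. if Poly_Mapping.lookup n i = k \<and> Poly_Mapping.update i 0 n = m
        then Poly_Mapping.lookup p n else 0)"
    unfolding as_poly_in_def subst_monomials_def coeff_sum lookup_sum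
    by (rule sum.cong) (auto simp: mult_single lookup_single when_def)
  also have "\<dots> = (if Poly_Mapping.lookup m i = 0
      then Poly_Mapping.lookup p (m + Poly_Mapping.single i k) else 0)"
    unfolding * by (auto simp: in_keys_iff)
  finally show ?thesis .
qed

lemma vars_coeff_as_poly_in: "vars (poly.coeff (as_poly_in i p) k) \<subseteq> vars p - {i}"
proof
  fix j assume "j \<in> vars (poly.coeff (as_poly_in i p) k)"
  then obtain m where m: "Poly_Mapping.lookup (poly.coeff (as_poly_in i p) k) m \<noteq> 0" "Poly_Mapping.lookup m j \<noteq> 0"
    by (auto simp: vars_def in_keys_iff)
  then have "Poly_Mapping.lookup m i = 0" "Poly_Mapping.lookup p (m + Poly_Mapping.single i k) \<noteq> 0"
    by (auto simp: lookup_coeff_as_poly_in split: if_splits)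
  with m show "j \<in> vars p - {i}"
    by (auto simp: vars_def in_keys_iff lookup_add intro!: bexI[of _ "m + Poly_Mapping.single i k"])
qed

lemma as_poly_in_free:
  assumes "i \<notin> vars p"
  shows "as_poly_in i p = [:p:]"
proof -
  have 0: "Poly_Mapping.lookup p m = 0" if "Poly_Mapping.lookup m i \<noteq> 0" for m
    using assms that by (metis UN_I in_keys_iff vars_def)
  show ?thesis
  proof (rule poly_eqI)
    fix k show "poly.coeff (as_poly_in i p) k = poly.coeff [:p:] k"
      by (cases k; intro poly_mapping_eqI)
        (auto simp: lookup_coeff_as_poly_in 0 lookup_add)
  qed
qed

lemma degree_as_poly_in_eq_0_iff: "Polynomial.degree (as_poly_in i p) = 0 \<longleftrightarrow> i \<notin> vars p"
proof
  assume "Polynomial.degree (as_poly_in i p) = 0"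
  then obtain c where c: "as_poly_in i p = [:c:]" by (rule degree_eq_zeroE)
  then have "p = c" using poly_as_poly_in_rvar[of i p] by simp
  then have "poly.coeff (as_poly_in i p) 0 = p" using c by simp
  then show "i \<notin> vars p" using vars_coeff_as_poly_in[of i p 0] by auto
qed (simp add: as_poly_in_free)

lemma vars_empty_iff: "vars p = {} \<longleftrightarrow> constant_poly p"
proof
  assume "vars p = {}"
  then have *: "Poly_Mapping.lookup p m = 0" if "m \<noteq> 0" for m
    using that unfolding vars_def by (auto simp: in_keys_iff)
  have "p = Poly_Mapping.single 0 (Poly_Mapping.lookup p 0)"
    by (rule poly_mapping_eqI) (auto simp: lookup_single when_def *)
  then show "constant_poly p" unfolding constant_poly_def by blast
qed (auto simp: constant_poly_def vars_def split: if_splits)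

lemma vars_add: "vars (p + q) \<subseteq> vars p \<union> vars q"
  using keys_add[of p q] by (auto simp: vars_def)

lemma vars_uminus: "vars (- p) = vars p"
  by (simp add: vars_def in_keys_iff[abs_def] set_eq_iff)

lemma vars_diff: "vars (p - q) \<subseteq> vars p \<union> vars q"
  using vars_add[of p "- q"] by (simp add: vars_uminus)

lemma vars_mult: "vars (p * q) \<subseteq> vars p \<union> vars q"
proof
  fix j assume "j \<in> vars (p * q)"
  then obtain a b where "a \<in> Poly_Mapping.keys p" "b \<in> Poly_Mapping.keys q" "j \<in> Poly_Mapping.keys (a + b)"
    using keys_mult[of p q] by (fastforce simp: vars_def)
  then show "j \<in> vars p \<union> vars q"
    using keys_add[of a b] by (auto simp: vars_def)
qed

lemma vars_1 [simp]: "vars 1 = {}"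
  by (simp add: vars_def)

lemma vars_0 [simp]: "vars 0 = {}"
  by (simp add: vars_def)

lemma vars_rvar [simp]: "vars (rvar i) = {i}"
  by (simp add: vars_def rvar_def)

lemma vars_power: "vars (p ^ k) \<subseteq> vars p"
proof (induction k)
  case (Suc k)
  then show ?case using vars_mult[of p "p ^ k"] by auto
qed simp

section \<open>Evaluation and the absence of zero divisors\<close>

lemma poly_eval_0 [simp]: "poly_eval 0 x = 0"
  by (simp add: poly_eval_def)

lemma poly_eval_1 [simp]: "poly_eval 1 x = 1"
  using poly_eval_single[of 0 1 x] by simp

lemma poly_eval_of_nat [simp]: "poly_eval (of_nat k) x = of_nat k"
  using poly_eval_single[of 0 "of_nat k" x] by simp

lemma poly_eval_rvar [simp]: "poly_eval (rvar i) x = (x :: real ^ 'n::finite) $ i"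
proof -
  have "x $ j ^ Poly_Mapping.lookup (Poly_Mapping.single i 1) j = (if j = i then x $ i else 1)" for j
    by (simp add: lookup_single when_def)
  then show ?thesis by (simp add: rvar_def poly_eval_single prod.delta)
qed

lemma poly_eval_sum: "poly_eval (sum F S) x = (\<Sum>s\<in>S. poly_eval (F s) x)"
  by (induction S rule: infinite_finite_induct) (simp_all add: poly_eval_add)

lemma poly_eval_prod: "poly_eval (prod F S) x = (\<Prod>s\<in>S. poly_eval (F s) x)"
  by (induction S rule: infinite_finite_induct) (simp_all add: poly_eval_mult)

lemma poly_eval_power: "poly_eval (p ^ k) x = poly_eval p x ^ k"
  by (induction k) (simp_all add: poly_eval_mult)

lemma poly_eval_cong:
  fixes x y :: "real ^ 'n::finite"
  assumes "\<And>i. i \<in> vars p \<Longrightarrow> x $ i = y $ i"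
  shows "poly_eval p x = poly_eval p y"
  unfolding poly_eval_def
proof (intro sum.cong arg_cong2[of _ _ _ _ "(*)"] prod.cong refl)
  fix m i assume "m \<in> Poly_Mapping.keys p"
  then have "x $ i = y $ i" if "Poly_Mapping.lookup m i \<noteq> 0"
    using that assms[of i] unfolding vars_def by (metis UN_I in_keys_iff)
  then show "x $ i ^ Poly_Mapping.lookup m i = y $ i ^ Poly_Mapping.lookup m i"
    by (cases "Poly_Mapping.lookup m i = 0") auto
qed

lemma continuous_poly_eval: "continuous_on S (poly_eval p)"
  unfolding poly_eval_def by (intro continuous_intros)

lemma poly_eval_line:
  fixes x :: "real ^ 'n::finite"
  shows "poly_eval p (\<chi> j. if j = i then t else x $ j)
    = (\<Sum>k\<le>Polynomial.degree (as_poly_in i p). poly_eval (poly.coeff (as_poly_in i p) k) x * t ^ k)"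
    (is "poly_eval p ?y = _")
proof -
  have coeffs: "poly_eval (poly.coeff (as_poly_in i p) k) ?y = poly_eval (poly.coeff (as_poly_in i p) k) x" for k
    using vars_coeff_as_poly_in[of i p k] by (intro poly_eval_cong) auto
  have "poly_eval p ?y = poly_eval (poly (as_poly_in i p) (rvar i)) ?y" by (simp add: poly_as_poly_in_rvar)
  also have "\<dots> = (\<Sum>k\<le>Polynomial.degree (as_poly_in i p). poly_eval (poly.coeff (as_poly_in i p) k) ?y * t ^ k)"
    by (simp add: poly_altdef poly_eval_sum poly_eval_mult poly_eval_power)
  also have "\<dots> = (\<Sum>k\<le>Polynomial.degree (as_poly_in i p). poly_eval (poly.coeff (as_poly_in i p) k) x * t ^ k)"
    by (simp add: coeffs)
  finally show ?thesis .
qed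

text \<open>
  By induction on the variables: for fixed values of the other variables, a univariate polynomial in
  the variable \<open>i\<close> with infinitely many zeros has zero coefficients, and these coefficients are
  polynomials in fewer variables that vanish on the same box.
\<close>

lemma vanishing_on_box_imp_zero:
  fixes p :: "'n::finite rpoly" and a b :: "real ^ 'n"
  assumes "\<And>i. a $ i < b $ i" and "\<And>x. (\<And>i. a $ i < x $ i \<and> x $ i < b $ i) \<Longrightarrow> poly_eval p x = 0"
  shows "p = 0"
proof -
  have "p = 0" if "finite V" "vars p \<subseteq> V"
    "\<And>x. (\<And>i. a $ i < x $ i \<and> x $ i < b $ i) \<Longrightarrow> poly_eval p x = 0" for V and p :: "'n rpoly"
    using that
  proof (induction V arbitrary: p rule: finite_induct)
    case empty
    then obtain c where c: "p = Poly_Mapping.single 0 c"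
      using vars_empty_iff[of p] by (auto simp: constant_poly_def)
    have "a $ i < ((a + b) /\<^sub>R 2) $ i \<and> ((a + b) /\<^sub>R 2) $ i < b $ i" for i
      using assms(1)[of i] by simp
    then have "poly_eval p ((a + b) /\<^sub>R 2) = 0" by (rule empty.prems(2))
    then show ?case by (simp add: c poly_eval_single)
  next
    case (insert i V)
    let ?c = "poly.coeff (as_poly_in i p)"
    have "?c k = 0" for k
    proof (cases "k \<le> Polynomial.degree (as_poly_in i p)")
      case True
      show ?thesis
      proof (rule insert.IH)
        show "vars (?c k) \<subseteq> V" using vars_coeff_as_poly_in[of i p k] insert.prems(1) by auto
        fix x assume x: "\<And>i. a $ i < x $ i \<and> x $ i < b $ i"
        have "{a $ i<..<b $ i} \<subseteq>
            {t. (\<Sum>k\<le>Polynomial.degree (as_poly_in i p). poly_eval (?c k) x * t ^ k) = 0}"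
          using x by (auto simp: poly_eval_line[symmetric] intro!: insert.prems(2))
        then have "infinite {t. (\<Sum>k\<le>Polynomial.degree (as_poly_in i p). poly_eval (?c k) x * t ^ k) = 0}"
          using assms(1)[of i] by (meson finite_subset infinite_Ioo)
        then show "poly_eval (?c k) x = 0"
          using polyfun_finite_roots[of "\<lambda>k. poly_eval (?c k) x"] True by blast
      qed
    qed (simp add: coeff_eq_0)
    then have "as_poly_in i p = 0" by (simp add: poly_eqI)
    then show ?case by (simp add: as_poly_in_eq_0_iff)
  qed
  from this[of UNIV p] assms(2) show ?thesis by simp
qed

lemma nonzero_on_open:
  fixes p :: "'n::finite rpoly"
  assumes "open U" "U \<noteq> {}" "p \<noteq> 0"
  shows "\<exists>x\<in>U. poly_eval p x \<noteq> 0"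
proof (rule ccontr)
  assume *: "\<not> ?thesis"
  obtain z where "z \<in> U" using assms(2) by blast
  then obtain a b :: "real ^ 'n" where ab: "z \<in> box a b" "box a b \<subseteq> U"
    using assms(1) open_contains_box by (metis box_subset_cbox order_trans)
  have "a $ i < b $ i" for i
    using ab(1) by (auto simp: mem_box_cart dest: order.strict_trans)
  moreover have "poly_eval p x = 0" if "\<And>i. a $ i < x $ i \<and> x $ i < b $ i" for x
  proof -
    have "x \<in> box a b" using that by (simp add: mem_box_cart)
    then show ?thesis using ab(2) * by blast
  qed
  ultimately show False using vanishing_on_box_imp_zero[of a b p] assms(3) by blast
qed

text \<open>
  The index type of the variables carries no order, so there is no leading monomial to multiply.
  Instead, the points where \<open>p\<close> is nonzero form a nonempty open set, on which \<open>q\<close> cannot vanish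
  identically.
\<close>

lemma rpoly_mult_eq_0_iff:
  fixes p q :: "'n::finite rpoly"
  shows "p * q = 0 \<longleftrightarrow> p = 0 \<or> q = 0"
proof
  assume pq: "p * q = 0"
  show "p = 0 \<or> q = 0"
  proof (rule ccontr)
    assume "\<not> ?thesis"
    then have nz: "p \<noteq> 0" "q \<noteq> 0" by auto
    let ?U = "{x. poly_eval p x \<noteq> 0}"
    have "open ?U"
      using continuous_poly_eval[of UNIV p] by (simp add: open_Collect_neq)
    moreover have "?U \<noteq> {}" using nonzero_on_open[of UNIV p] nz by auto
    ultimately obtain x where "poly_eval p x \<noteq> 0" "poly_eval q x \<noteq> 0"
      using nonzero_on_open[of ?U q] nz by auto
    then show False using arg_cong[OF pq, of "\<lambda>r. poly_eval r x"] by (simp add: poly_eval_mult)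
  qed
qed auto

lemma rpoly_mult_left_cancel:
  fixes p q r :: "'n::finite rpoly"
  assumes "p \<noteq> 0"
  shows "p * q = p * r \<longleftrightarrow> q = r"
  using rpoly_mult_eq_0_iff[of p "q - r"] assms by (auto simp: algebra_simps)

lemma rpoly_power_eq_0_iff:
  fixes p :: "'n::finite rpoly"
  shows "p ^ k = 0 \<longleftrightarrow> p = 0 \<and> k > 0"
  by (induction k) (auto simp: rpoly_mult_eq_0_iff)

section \<open>Irreducible polynomials are prime\<close>

lemma degree_as_poly_in_mult:
  fixes p q :: "'n::finite rpoly"
  assumes "p \<noteq> 0" "q \<noteq> 0"
  shows "Polynomial.degree (as_poly_in i (p * q)) = Polynomial.degree (as_poly_in i p) + Polynomial.degree (as_poly_in i q)"
proof (rule antisym)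
  show "Polynomial.degree (as_poly_in i (p * q)) \<le> Polynomial.degree (as_poly_in i p) + Polynomial.degree (as_poly_in i q)"
    unfolding as_poly_in_mult by (rule Polynomial.degree_mult_le)
  have "poly.coeff (as_poly_in i p * as_poly_in i q) (Polynomial.degree (as_poly_in i p) + Polynomial.degree (as_poly_in i q)) \<noteq> 0"
    using assms by (simp add: coeff_mult_degree_sum rpoly_mult_eq_0_iff as_poly_in_eq_0_iff)
  then show "Polynomial.degree (as_poly_in i p) + Polynomial.degree (as_poly_in i q) \<le> Polynomial.degree (as_poly_in i (p * q))"
    unfolding as_poly_in_mult by (rule le_degree)
qed

lemma vars_mult_eq:
  fixes p q :: "'n::finite rpoly"
  assumes "p \<noteq> 0" "q \<noteq> 0"
  shows "vars (p * q) = vars p \<union> vars q"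
proof (rule Set.set_eqI)
  fix i show "i \<in> vars (p * q) \<longleftrightarrow> i \<in> vars p \<union> vars q"
    using degree_as_poly_in_mult[OF assms, of i] degree_as_poly_in_eq_0_iff[of i "p * q"]
      degree_as_poly_in_eq_0_iff[of i p] degree_as_poly_in_eq_0_iff[of i q] by auto
qed

lemma unit_iff_vars_empty:
  fixes p :: "'n::finite rpoly"
  assumes "p \<noteq> 0"
  shows "p dvd 1 \<longleftrightarrow> vars p = {}"
  using assms by (simp add: dvd_1_iff_constant_poly vars_empty_iff)

text \<open>
  The measure for splitting off irreducible factors. Summing the degrees in the single variables makes
  it additive for products, and it is zero exactly for constants.
\<close>

definition deg_sum :: "'n::finite rpoly \<Rightarrow> nat" where
  "deg_sum p = (\<Sum>i\<in>UNIV. Polynomial.degree (as_poly_in i p))"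

lemma deg_sum_mult:
  "p \<noteq> 0 \<Longrightarrow> q \<noteq> 0 \<Longrightarrow> deg_sum (p * q) = deg_sum p + deg_sum q"
  by (simp add: deg_sum_def degree_as_poly_in_mult sum.distrib)

lemma deg_sum_eq_0_iff: "p \<noteq> 0 \<Longrightarrow> deg_sum p = 0 \<longleftrightarrow> p dvd 1"
  by (auto simp: deg_sum_def degree_as_poly_in_eq_0_iff unit_iff_vars_empty)

lemma irreducible_factor_exists:
  fixes p :: "'n::finite rpoly"
  assumes "p \<noteq> 0" "\<not> p dvd 1"
  shows "\<exists>q. irreducible_poly q \<and> q dvd p"
  using assms
proof (induction "deg_sum p" arbitrary: p rule: less_induct)
  case less
  show ?case
  proof (cases "irreducible_poly p")
    case False
    then obtain a b where ab: "p = a * b" "\<not> a dvd 1" "\<not> b dvd 1"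
      using less.prems unfolding comm_semiring_1_class.irreducible_def by blast
    then have nz: "a \<noteq> 0" "b \<noteq> 0" using less.prems by auto
    then have "deg_sum a < deg_sum p"
      using ab deg_sum_mult[of a b] deg_sum_eq_0_iff[of b] by simp
    then show ?thesis using less.hyps[of a] nz ab by (metis dvd_mult2)
  qed auto
qed

text \<open>
  Induction along a prime factorization: if irreducible polynomials in the variables \<open>V\<close> are prime,
  then every nonzero polynomial in \<open>V\<close> arises from a unit by multiplying with primes, one at a time.
\<close>

lemma prime_product_induct [consumes 3, case_names unit mult]:
  fixes c :: "'n::finite rpoly"
  assumes primes: "\<forall>q. irreducible_poly q \<longrightarrow> vars q \<subseteq> V \<longrightarrow> prime_elem q"
    and "c \<noteq> 0" "vars c \<subseteq> V"
    and unit: "\<And>u. u dvd 1 \<Longrightarrow> Q u"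
    and mult: "\<And>q c. prime_elem q \<Longrightarrow> irreducible_poly q \<Longrightarrow> vars q \<subseteq> V \<Longrightarrow> Q c \<Longrightarrow> Q (q * c)"
  shows "Q c"
  using assms(2,3)
proof (induction "deg_sum c" arbitrary: c rule: less_induct)
  case less
  show ?case
  proof (cases "c dvd 1")
    case False
    then obtain q where q: "irreducible_poly q" "q dvd c"
      using irreducible_factor_exists less.prems by blast
    then obtain c' where c': "c = q * c'" unfolding dvd_def by blast
    have nz: "q \<noteq> 0" "c' \<noteq> 0" using less.prems c' by auto
    have v: "vars q \<subseteq> V" "vars c' \<subseteq> V" using vars_mult_eq[OF nz] less.prems c' by auto
    have "\<not> q dvd 1" using q(1) by (simp add: comm_semiring_1_class.irreducible_def)
    then have "deg_sum c' < deg_sum c"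
      using nz deg_sum_mult[OF nz] deg_sum_eq_0_iff[of q] c' by simp
    then have "Q c'" using less.hyps nz v by blast
    then show ?thesis using mult[of q c'] primes q v c' by blast
  qed (rule unit)
qed

lemma unit_mult_dvd_cancel:
  fixes f :: "'a::comm_semiring_1"
  assumes "u dvd 1" "f dvd u * h"
  shows "f dvd h"
proof -
  obtain v where v: "1 = u * v" using assms(1) unfolding dvd_def by blast
  have "f dvd v * (u * h)" using assms(2) by simp
  also have "v * (u * h) = (u * v) * h" by (simp add: ac_simps)
  also have "\<dots> = h" using v by simp
  finally show ?thesis .
qed

text \<open>
  A prime factor of \<open>c\<close> is a polynomial in \<open>V\<close>. It cannot divide the irreducible \<open>f\<close>, which involves
  a variable outside \<open>V\<close>. So it can be cancelled against the cofactor of \<open>f\<close>.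
\<close>

lemma dvd_cancel_coefficient:
  fixes f :: "'n::finite rpoly"
  assumes "\<forall>q. irreducible_poly q \<longrightarrow> vars q \<subseteq> V \<longrightarrow> prime_elem q"
    and "c \<noteq> 0" "vars c \<subseteq> V"
    and f: "irreducible_poly f" "\<not> vars f \<subseteq> V"
    and "f dvd c * h"
  shows "f dvd h"
proof -
  have "\<forall>h. f dvd c * h \<longrightarrow> f dvd h"
    using assms(1-3)
  proof (induction rule: prime_product_induct)
    case (unit u)
    then show ?case using unit_mult_dvd_cancel by blast
  next
    case (mult q c)
    show ?case
    proof (intro allI impI)
      fix h assume "f dvd q * c * h"
      then obtain e where e: "q * (c * h) = f * e" unfolding dvd_def by (auto simp: ac_simps)
      have q0: "q \<noteq> 0" using mult.hyps(1) by (simp add: comm_semiring_1_class.prime_elem_def)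
      have "q dvd f * e" using e by (metis dvd_triv_left)
      then have "q dvd f \<or> q dvd e"
        using mult.hyps(1) by (simp add: comm_semiring_1_class.prime_elem_def)
      moreover have "\<not> q dvd f"
      proof
        assume "q dvd f"
        then obtain t where t: "f = q * t" unfolding dvd_def by blast
        have "\<not> q dvd 1" using mult.hyps(1) by (simp add: comm_semiring_1_class.prime_elem_def)
        then have "t dvd 1" using t f(1) by (auto simp: comm_semiring_1_class.irreducible_def)
        moreover from this have "t \<noteq> 0" by auto
        ultimately have "vars t = {}" using unit_iff_vars_empty by blast
        then show False using vars_mult[of q t] t mult.hyps(3) f(2) by auto
      qed
      ultimately obtain e' where "e = q * e'" unfolding dvd_def by blast
      then have "q * (c * h) = q * (f * e')" using e by (simp add: ac_simps)
      then have "c * h = f * e'" using rpoly_mult_left_cancel[OF q0] by blast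
      then have "f dvd c * h" by simp
      then show "f dvd h" using mult.IH by blast
    qed
  qed
  then show ?thesis using assms(6) by blast
qed

text \<open>
  This is the part of Gauss's lemma that is needed: each prime factor of \<open>c\<close> divides \<open>g\<close> or \<open>h\<close> and
  is cancelled there. This leaves \<open>f = g' * h'\<close>, where \<open>h'\<close> divides \<open>h\<close> and still involves a variable
  outside \<open>V\<close>; hence \<open>g'\<close> is a unit.
\<close>

lemma irreducible_dvd_pseudo_divisor:
  fixes f :: "'n::finite rpoly"
  assumes "\<forall>q. irreducible_poly q \<longrightarrow> vars q \<subseteq> V \<longrightarrow> prime_elem q"
    and "c \<noteq> 0" "vars c \<subseteq> V"
    and f: "irreducible_poly f"
    and "c * f = g * h" "\<not> vars h \<subseteq> V"
  shows "f dvd h"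
proof -
  have "\<forall>g h. \<not> vars h \<subseteq> V \<longrightarrow> c * f = g * h \<longrightarrow> f dvd h"
    using assms(1-3)
  proof (induction rule: prime_product_induct)
    case (unit u)
    show ?case
    proof (intro allI impI)
      fix g h assume h: "\<not> vars h \<subseteq> V" "u * f = g * h"
      obtain v where v: "1 = u * v" using unit unfolding dvd_def by blast
      have "f = (u * v) * f" using v[symmetric] by simp
      also have "\<dots> = v * (u * f)" by (simp add: ac_simps)
      also have "\<dots> = (v * g) * h" unfolding h(2) by (simp add: ac_simps)
      finally have eq: "f = (v * g) * h" .
      have "h \<noteq> 0" using h(1) by auto
      then have "\<not> h dvd 1" using h(1) unit_iff_vars_empty[of h] by auto
      then have "v * g dvd 1" using f eq by (auto simp: comm_semiring_1_class.irreducible_def)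
      then show "f dvd h" by (rule unit_mult_dvd_cancel) (simp add: eq[symmetric])
    qed
  next
    case (mult q c)
    show ?case
    proof (intro allI impI)
      fix g h assume h: "\<not> vars h \<subseteq> V" "q * c * f = g * h"
      have q0: "q \<noteq> 0" using mult.hyps(1) by (simp add: comm_semiring_1_class.prime_elem_def)
      have "q dvd g * h" using h(2) by (metis dvd_triv_left mult.assoc)
      then have "q dvd g \<or> q dvd h"
        using mult.hyps(1) by (simp add: comm_semiring_1_class.prime_elem_def)
      then show "f dvd h"
      proof
        assume "q dvd g"
        then obtain t where "g = q * t" unfolding dvd_def by blast
        then have "q * (c * f) = q * (t * h)" using h(2) by (simp add: ac_simps)
        then have "c * f = t * h" using rpoly_mult_left_cancel[OF q0] by blast
        then show ?thesis using mult.IH h(1) by blast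
      next
        assume "q dvd h"
        then obtain t where t: "h = q * t" unfolding dvd_def by blast
        then have "q * (c * f) = q * (g * t)" using h(2) by (simp add: ac_simps)
        then have "c * f = g * t" using rpoly_mult_left_cancel[OF q0] by blast
        moreover have "\<not> vars t \<subseteq> V" using h(1) t vars_mult[of q t] mult.hyps(3) by blast
        ultimately have "f dvd t" using mult.IH by blast
        then show ?thesis using t by simp
      qed
    qed
  qed
  then show ?thesis using assms(5,6) by blast
qed

text \<open>
  Division with remainder by \<open>h\<close> in the variable \<open>i\<close>. Each step multiplies \<open>p\<close> by the leading
  coefficient of \<open>h\<close>, so that \<open>c\<close> is a power of this coefficient.
\<close>

lemma pseudo_division:
  fixes h p :: "'n::finite rpoly"
  assumes h: "h \<noteq> 0" "vars h \<subseteq> insert i V" and p: "vars p \<subseteq> insert i V"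
  shows "\<exists>c q. c \<noteq> 0 \<and> vars c \<subseteq> V \<and> vars q \<subseteq> insert i V \<and>
    (\<forall>k\<ge>Polynomial.degree (as_poly_in i h). poly.coeff (as_poly_in i (c * p - q * h)) k = 0)"
proof -
  define n where "n = Polynomial.degree (as_poly_in i h)"
  define l where "l = poly.coeff (as_poly_in i h) n"
  have l: "l \<noteq> 0" "vars l \<subseteq> V"
    using h vars_coeff_as_poly_in[of i h n] by (auto simp: l_def n_def as_poly_in_eq_0_iff)
  have "\<exists>c q. c \<noteq> 0 \<and> vars c \<subseteq> V \<and> vars q \<subseteq> insert i V \<and>
    (\<forall>k\<ge>n. poly.coeff (as_poly_in i (c * p - q * h)) k = 0)"
    if "vars p \<subseteq> insert i V" "\<forall>k\<ge>N. poly.coeff (as_poly_in i p) k = 0" for N p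
    using that
  proof (induction N arbitrary: p)
    case 0
    then show ?case by (intro exI[of _ 1] exI[of _ 0]) auto
  next
    case (Suc N)
    show ?case
    proof (cases "N \<ge> n")
      case False
      then have "Suc N \<le> k" if "n \<le> k" for k using that by simp
      then show ?thesis using Suc.prems by (intro exI[of _ 1] exI[of _ 0]) auto
    next
      case True
      define a where "a = poly.coeff (as_poly_in i p) N"
      have a: "vars a \<subseteq> V" using vars_coeff_as_poly_in[of i p N] Suc.prems(1) by (auto simp: a_def)
      \<comment> \<open>subtracting \<open>s * h\<close> from \<open>l * p\<close> cancels the coefficient of degree \<open>N\<close>\<close>
      define s where "s = a * rvar i ^ (N - n)"
      have s: "vars s \<subseteq> insert i V"
        using vars_mult[of a "rvar i ^ (N - n)"] vars_power[of "rvar i" "N - n"] a by (auto simp: s_def)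
      have "i \<notin> vars l" "i \<notin> vars a"
        using vars_coeff_as_poly_in[of i h n] vars_coeff_as_poly_in[of i p N] by (auto simp: l_def a_def)
      then have u: "as_poly_in i (l * p - s * h) = Polynomial.smult l (as_poly_in i p) - Polynomial.monom a (N - n) * as_poly_in i h"
        by (simp add: as_poly_in_diff as_poly_in_mult as_poly_in_power as_poly_in_free s_def monom_power Polynomial.smult_monom)
      have "vars (l * p - s * h) \<subseteq> insert i V"
        using vars_diff[of "l * p" "s * h"] vars_mult[of l p] vars_mult[of s h] l s h Suc.prems(1)
        by blast
      moreover have "\<forall>k\<ge>N. poly.coeff (as_poly_in i (l * p - s * h)) k = 0"
      proof (intro allI impI)
        fix k assume k: "N \<le> k"
        show "poly.coeff (as_poly_in i (l * p - s * h)) k = 0"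
        proof (cases "k = N")
          case eq: True
          have "poly.coeff (as_poly_in i (l * p - s * h)) N = l * a - a * l"
            using True unfolding u by (simp add: coeff_monom_mult a_def l_def)
          then show ?thesis using eq by (simp add: mult.commute)
        next
          case False
          then have "poly.coeff (as_poly_in i h) (k - (N - n)) = 0"
            using True k by (intro coeff_eq_0) (simp add: n_def)
          then show ?thesis using k False Suc.prems(2) by (simp add: u coeff_monom_mult)
        qed
      qed
      ultimately obtain c q where cq: "c \<noteq> 0" "vars c \<subseteq> V" "vars q \<subseteq> insert i V"
        "\<forall>k\<ge>n. poly.coeff (as_poly_in i (c * (l * p - s * h) - q * h)) k = 0"
        using Suc.IH by blast
      have "c * (l * p - s * h) - q * h = (c * l) * p - (c * s + q) * h"
        by (simp add: algebra_simps)
      moreover have "c * l \<noteq> 0" using cq(1) l(1) by (simp add: rpoly_mult_eq_0_iff)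
      moreover have "vars (c * l) \<subseteq> V" using vars_mult[of c l] cq(2) l(2) by blast
      moreover have "vars (c * s + q) \<subseteq> insert i V"
        using vars_add[of "c * s" q] vars_mult[of c s] cq(2,3) s by blast
      ultimately show ?thesis using cq(4) by metis
    qed
  qed
  moreover have "\<forall>k\<ge>Suc (Polynomial.degree (as_poly_in i p)). poly.coeff (as_poly_in i p) k = 0"
    by (auto intro: coeff_eq_0)
  ultimately show ?thesis using p unfolding n_def by blast
qed

text \<open>
  Primality tested only on polynomials in the variables \<open>V\<close>. Degree arguments in one variable need
  coefficients in the remaining variables of \<open>V\<close>, which confines them to such polynomials.
\<close>

definition prime_on :: "'n set \<Rightarrow> 'n rpoly \<Rightarrow> bool" where
  "prime_on V f \<longleftrightarrow> (\<forall>g h. vars g \<subseteq> V \<longrightarrow> vars h \<subseteq> V \<longrightarrow> f dvd g * h \<longrightarrow> f dvd g \<or> f dvd h)"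

text \<open>
  Suppose \<open>f\<close> divides \<open>g * g'\<close>, and let \<open>h\<close> be a nonzero element of least degree in the variable \<open>i\<close>
  in the ideal generated by \<open>f\<close> and \<open>g\<close>. By pseudo-division, \<open>h\<close> divides multiples of \<open>f\<close> and of
  \<open>g\<close> by nonzero polynomials in \<open>V\<close>. If \<open>h\<close> involves \<open>i\<close>, then \<open>f\<close> divides \<open>h\<close> and hence \<open>g\<close>.
  Otherwise \<open>h\<close> is itself such a polynomial, and \<open>f\<close> divides \<open>h * g'\<close>, hence \<open>g'\<close>.
\<close>

lemma prime_on_new_variable:
  fixes f :: "'n::finite rpoly"
  assumes primes: "\<forall>q. irreducible_poly q \<longrightarrow> vars q \<subseteq> V \<longrightarrow> prime_elem q"
    and f: "irreducible_poly f" "vars f \<subseteq> insert i V" "\<not> vars f \<subseteq> V"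
  shows "prime_on (insert i V) f"
  unfolding prime_on_def
proof (intro allI impI)
  fix g g' assume g: "vars g \<subseteq> insert i V" "vars g' \<subseteq> insert i V" "f dvd g * g'"
  define J where "J = {h. h \<noteq> 0 \<and> (\<exists>u v. vars u \<subseteq> insert i V \<and> vars v \<subseteq> insert i V \<and> h = u * f + v * g)}"
  have "f = 1 * f + 0 * g" by simp
  moreover have "f \<noteq> 0" using f(1) by (simp add: comm_semiring_1_class.irreducible_def)
  ultimately have "f \<in> J" unfolding J_def by (metis (mono_tags, lifting) empty_subsetI mem_Collect_eq vars_0 vars_1)
  then obtain h where h: "h \<in> J" and
    min: "\<And>h'. h' \<in> J \<Longrightarrow> Polynomial.degree (as_poly_in i h) \<le> Polynomial.degree (as_poly_in i h')"
    using ex_has_least_nat[of "\<lambda>h. h \<in> J" f "\<lambda>h. Polynomial.degree (as_poly_in i h)"] by blast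
  obtain u v where uv: "h \<noteq> 0" "vars u \<subseteq> insert i V" "vars v \<subseteq> insert i V" "h = u * f + v * g"
    using h by (auto simp: J_def)
  have hV: "vars h \<subseteq> insert i V"
    using vars_add[of "u * f" "v * g"] vars_mult[of u f] vars_mult[of v g] uv f(2) g(1) by blast
  have div: "\<exists>c q. c \<noteq> 0 \<and> vars c \<subseteq> V \<and> c * p = q * h"
    if p: "p = a * f + b * g" "vars a \<subseteq> insert i V" "vars b \<subseteq> insert i V" for p a b
  proof -
    have pV: "vars p \<subseteq> insert i V"
      using vars_add[of "a * f" "b * g"] vars_mult[of a f] vars_mult[of b g] p f(2) g(1) by blast
    obtain c q where cq: "c \<noteq> 0" "vars c \<subseteq> V" "vars q \<subseteq> insert i V"
      "\<forall>k\<ge>Polynomial.degree (as_poly_in i h). poly.coeff (as_poly_in i (c * p - q * h)) k = 0"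
      using pseudo_division[OF uv(1) hV pV] by blast
    have "c * p - q * h = 0"
    proof (rule ccontr)
      assume nz: "c * p - q * h \<noteq> 0"
      have "c * p - q * h = (c * a - q * u) * f + (c * b - q * v) * g"
        by (simp add: p(1) uv(4) algebra_simps)
      moreover have "vars (c * a - q * u) \<subseteq> insert i V" "vars (c * b - q * v) \<subseteq> insert i V"
        using vars_diff[of "c * a" "q * u"] vars_diff[of "c * b" "q * v"] vars_mult[of c a]
          vars_mult[of q u] vars_mult[of c b] vars_mult[of q v] cq(2,3) p(2,3) uv(2,3) by blast+
      ultimately have "c * p - q * h \<in> J" using nz unfolding J_def by blast
      then have "poly.coeff (as_poly_in i (c * p - q * h)) (Polynomial.degree (as_poly_in i (c * p - q * h))) = 0"
        using min cq(4) by blast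
      then show False using nz by (simp add: as_poly_in_eq_0_iff)
    qed
    then show ?thesis using cq by auto
  qed
  obtain c q where c: "c \<noteq> 0" "vars c \<subseteq> V" "c * f = q * h"
    using div[of f 1 0] by auto
  obtain c' q' where c': "c' \<noteq> 0" "vars c' \<subseteq> V" "c' * g = q' * h"
    using div[of g 0 1] by auto
  show "f dvd g \<or> f dvd g'"
  proof (cases "vars h \<subseteq> V")
    case True
    have "h * g' = f * (u * g') + v * (g * g')" by (simp add: uv(4) algebra_simps)
    then have "f dvd h * g'" using g(3) by simp
    then show ?thesis using dvd_cancel_coefficient[OF primes uv(1) True f(1,3)] by blast
  next
    case False
    then have "f dvd h" using irreducible_dvd_pseudo_divisor[OF primes c(1,2) f(1) c(3)] by blast
    then have "f dvd c' * g" using c'(3) by simp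
    then show ?thesis using dvd_cancel_coefficient[OF primes c'(1,2) f(1,3)] by blast
  qed
qed

lemma dvd_iff_dvd_coeffs:
  assumes "i \<notin> vars f"
  shows "f dvd g \<longleftrightarrow> (\<forall>k. f dvd poly.coeff (as_poly_in i g) k)"
proof
  assume "f dvd g"
  then obtain t where "g = f * t" unfolding dvd_def by blast
  then show "\<forall>k. f dvd poly.coeff (as_poly_in i g) k"
    using assms by (simp add: as_poly_in_mult as_poly_in_free)
next
  assume "\<forall>k. f dvd poly.coeff (as_poly_in i g) k"
  then have "f dvd poly (as_poly_in i g) (rvar i)"
    unfolding poly_altdef by (intro dvd_sum) auto
  then show "f dvd g" by (simp add: poly_as_poly_in_rvar)
qed

text \<open>
  If neither \<open>g\<close> nor \<open>h\<close> is divisible by \<open>f\<close>, take in each the lowest coefficient in the variable \<open>i\<close>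
  that is not divisible by \<open>f\<close>. Modulo \<open>f\<close>, their product is the only contribution to one coefficient
  of \<open>g * h\<close>.
\<close>

lemma prime_on_insert:
  fixes f :: "'n::finite rpoly"
  assumes f: "prime_on V f" "i \<notin> vars f"
  shows "prime_on (insert i V) f"
  unfolding prime_on_def
proof (intro allI impI, rule ccontr)
  fix g h assume gh: "vars g \<subseteq> insert i V" "vars h \<subseteq> insert i V" "f dvd g * h" "\<not> (f dvd g \<or> f dvd h)"
  define a where "a = (LEAST k. \<not> f dvd poly.coeff (as_poly_in i g) k)"
  define b where "b = (LEAST k. \<not> f dvd poly.coeff (as_poly_in i h) k)"
  have a: "\<not> f dvd poly.coeff (as_poly_in i g) a" and b: "\<not> f dvd poly.coeff (as_poly_in i h) b"
    using gh(4) dvd_iff_dvd_coeffs[OF f(2)] unfolding a_def b_def by (metis (lifting) LeastI)+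
  have less: "f dvd poly.coeff (as_poly_in i g) k" if "k < a" for k
    using that not_less_Least unfolding a_def by blast
  have less': "f dvd poly.coeff (as_poly_in i h) k" if "k < b" for k
    using that not_less_Least unfolding b_def by blast
  let ?t = "\<lambda>k. poly.coeff (as_poly_in i g) k * poly.coeff (as_poly_in i h) (a + b - k)"
  have "f dvd poly.coeff (as_poly_in i (g * h)) (a + b)"
    using gh(3) dvd_iff_dvd_coeffs[OF f(2)] by blast
  then have "f dvd (\<Sum>k\<le>a + b. ?t k)" by (simp add: as_poly_in_mult coeff_mult)
  moreover have "(\<Sum>k\<le>a + b. ?t k) = ?t a + (\<Sum>k\<in>{..a + b} - {a}. ?t k)"
    by (subst sum.remove[of _ a]) auto
  moreover have "f dvd (\<Sum>k\<in>{..a + b} - {a}. ?t k)"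
  proof (rule dvd_sum)
    fix k assume "k \<in> {..a + b} - {a}"
    then have "k < a \<or> a + b - k < b" by auto
    then show "f dvd ?t k" using less less' by auto
  qed
  ultimately have "f dvd poly.coeff (as_poly_in i g) a * poly.coeff (as_poly_in i h) b"
    by (simp add: dvd_add_left_iff)
  moreover have "vars (poly.coeff (as_poly_in i g) a) \<subseteq> V" "vars (poly.coeff (as_poly_in i h) b) \<subseteq> V"
    using vars_coeff_as_poly_in[of i g a] vars_coeff_as_poly_in[of i h b] gh(1,2) by auto
  ultimately show False using f(1) a b unfolding prime_on_def by blast
qed

lemma prime_on_imp_prime_elem:
  fixes f :: "'n::finite rpoly"
  assumes "prime_on V f" "vars f \<subseteq> V" "f \<noteq> 0" "\<not> f dvd 1"
  shows "prime_elem f"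
proof -
  have "prime_on (V \<union> W) f" if "finite W" "W \<inter> V = {}" for W
    using that
  proof (induction W rule: finite_induct)
    case (insert i W)
    then have "i \<notin> vars f" using assms(2) by auto
    then show ?case using prime_on_insert[of "V \<union> W" f i] insert by simp
  qed (simp add: assms(1))
  from this[of "- V"] have "prime_on UNIV f" by simp
  then show ?thesis
    using assms(3,4) by (auto simp: prime_on_def comm_semiring_1_class.prime_elem_def)
qed

text \<open>
  Gauss's theorem for polynomials in several variables, by induction on the variables that occur in
  \<open>f\<close>.
\<close>

theorem irreducible_rpoly_imp_prime:
  fixes f :: "'n::finite rpoly"
  assumes "irreducible_poly f"
  shows "prime_elem f"
proof -
  have "prime_elem f" if "finite V" "irreducible_poly f" "vars f \<subseteq> V" for V and f :: "'n rpoly"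
    using that
  proof (induction V arbitrary: f rule: finite_induct)
    case empty
    then show ?case using unit_iff_vars_empty[of f] by (auto simp: comm_semiring_1_class.irreducible_def)
  next
    case (insert i V)
    show ?case
    proof (cases "vars f \<subseteq> V")
      case False
      have "prime_on (insert i V) f"
        using prime_on_new_variable[OF _ insert.prems False] insert.IH by blast
      then show ?thesis
        using prime_on_imp_prime_elem insert.prems by (auto simp: comm_semiring_1_class.irreducible_def)
    qed (use insert in blast)
  qed
  from this[of UNIV f] assms show ?thesis by simp
qed

section \<open>Chains of prime ideals\<close>

text \<open>
  Prime ideals as plain sets. The equivalence in the last clause covers both absorption and primality.
\<close>

definition prime_set :: "'a::comm_ring_1 set \<Rightarrow> bool" where
  "prime_set P \<longleftrightarrow> 0 \<in> P \<and> 1 \<notin> P \<and> (\<forall>a\<in>P. \<forall>b\<in>P. a + b \<in> P) \<and>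
     (\<forall>a b. a * b \<in> P \<longleftrightarrow> a \<in> P \<or> b \<in> P)"

lemma prime_set_sum:
  assumes "prime_set P" "\<And>s. s \<in> S \<Longrightarrow> F s \<in> P"
  shows "sum F S \<in> P"
  using assms(2) by (induction S rule: infinite_finite_induct)
    (use assms(1) in \<open>auto simp: prime_set_def\<close>)

lemma prime_set_power:
  assumes "prime_set P"
  shows "a ^ k \<in> P \<longleftrightarrow> a \<in> P \<and> k > 0"
  using assms by (induction k) (auto simp: prime_set_def)

lemma prime_set_add_cancel:
  assumes "prime_set P" "a + b \<in> P" "b \<in> P"
  shows "a \<in> P"
proof -
  have "(-1) * b \<in> P" using assms(1,3) unfolding prime_set_def by blast
  then have "(a + b) + (-1) * b \<in> P" using assms(1,2) unfolding prime_set_def by blast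
  then show ?thesis by simp
qed

definition power_prod :: "'a::comm_ring_1 list \<Rightarrow> nat list \<Rightarrow> 'a" where
  "power_prod ys ms = prod_list (map2 (^) ys ms)"

text \<open>
  Let \<open>y\<^sub>i\<close> be in the \<open>i + 1\<close>-st but not in the \<open>i\<close>-th prime of a chain. Then no nontrivial linear
  combination of products of powers of the \<open>y\<^sub>i\<close> lies in the bottom prime. In such a combination, let
  \<open>k\<close> be the lowest exponent of the first element \<open>y\<close> and cancel \<open>y ^ k\<close>, which is possible because
  \<open>y\<close> is outside the bottom prime. All terms that still contain \<open>y\<close> lie in the next prime, hence so
  does the combination of the other terms, which is shorter by one element.
\<close>

lemma prime_chain_powers_independent:
  fixes P :: "nat \<Rightarrow> 'n::finite rpoly set" and c :: "nat list \<Rightarrow> real"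
  assumes "\<forall>i\<le>length ys. prime_set (P i)"
    and "\<forall>i<length ys. P i \<subseteq> P (Suc i) \<and> ys ! i \<in> P (Suc i) - P i"
    and "(\<Sum>ms\<in>{ms. set ms \<subseteq> {..<N} \<and> length ms = length ys}.
      Poly_Mapping.single 0 (c ms) * power_prod ys ms) \<in> P 0"
    and "set ms \<subseteq> {..<N}" "length ms = length ys"
  shows "c ms = 0"
  using assms
proof (induction ys arbitrary: P c ms)
  case Nil
  have "{ms::nat list. set ms \<subseteq> {..<N} \<and> length ms = length ([] :: 'n rpoly list)} = {[]}" by auto
  then have *: "Poly_Mapping.single 0 (c []) \<in> P 0"
    using Nil.prems(3) by (simp add: power_prod_def)
  show ?case
  proof (rule ccontr)
    assume "c ms \<noteq> 0"
    then have "c [] \<noteq> 0" using Nil.prems(5) by simp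
    then have "(1 :: 'n rpoly) = Poly_Mapping.single 0 (c []) * Poly_Mapping.single 0 (1 / c [])"
      by (simp add: mult_single)
    moreover have "prime_set (P 0)" using Nil.prems(1) by simp
    ultimately show False using * unfolding prime_set_def by metis
  qed
next
  case (Cons y ys)
  define L where "L = {ms. set ms \<subseteq> {..<N} \<and> length ms = length ys}"
  have finL: "finite L" unfolding L_def by (rule finite_lists_length_eq) simp
  define T where "T k = (\<Sum>ms\<in>L. Poly_Mapping.single 0 (c (k # ms)) * power_prod ys ms)" for k
  have lists: "{ms. set ms \<subseteq> {..<N} \<and> length ms = length (y # ys)} = (\<lambda>(k, ms). k # ms) ` ({..<N} \<times> L)"
    by (auto simp: L_def image_iff length_Suc_conv)
  have "(\<Sum>ms\<in>{ms. set ms \<subseteq> {..<N} \<and> length ms = length (y # ys)}.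
        Poly_Mapping.single 0 (c ms) * power_prod (y # ys) ms)
      = (\<Sum>(k, ms)\<in>{..<N} \<times> L. Poly_Mapping.single 0 (c (k # ms)) * power_prod (y # ys) (k # ms))"
    unfolding lists by (subst sum.reindex) (auto simp: inj_on_def case_prod_unfold)
  also have "\<dots> = (\<Sum>k<N. \<Sum>ms\<in>L. Poly_Mapping.single 0 (c (k # ms)) * power_prod (y # ys) (k # ms))"
    by (rule sum.cartesian_product[symmetric])
  also have "\<dots> = (\<Sum>k<N. y ^ k * T k)"
    by (simp add: T_def power_prod_def sum_distrib_left ac_simps)
  finally have sumP: "(\<Sum>k<N. y ^ k * T k) \<in> P 0" using Cons.prems(3) by simp
  have P: "prime_set (P 0)" "prime_set (P 1)" "P 0 \<subseteq> P 1" "y \<in> P 1" "y \<notin> P 0"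
    using Cons.prems(1,2) by (auto dest: spec[of _ 0] spec[of _ 1])
  have "\<forall>ms\<in>L. c (k # ms) = 0" if "k < N" for k
    using that
  proof (induction k rule: less_induct)
    case (less k)
    have T0: "T j = 0" if "j < k" for j
      using less that by (simp add: T_def)
    have "(\<Sum>j<N. y ^ j * T j) = (\<Sum>j\<in>{k..<N}. y ^ j * T j)"
      by (rule sum.mono_neutral_right) (auto simp: T0)
    also have "\<dots> = y ^ k * (\<Sum>j\<in>{k..<N}. y ^ (j - k) * T j)"
      unfolding sum_distrib_left
      by (rule sum.cong) (auto simp: mult.assoc[symmetric] power_add[symmetric])
    finally have "y ^ k * (\<Sum>j\<in>{k..<N}. y ^ (j - k) * T j) \<in> P 0"
      using sumP by simp
    moreover have "y ^ k \<notin> P 0" using P(5) prime_set_power[OF P(1)] by blast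
    ultimately have "(\<Sum>j\<in>{k..<N}. y ^ (j - k) * T j) \<in> P 0"
      using P(1) unfolding prime_set_def by blast
    moreover have "(\<Sum>j\<in>{k..<N}. y ^ (j - k) * T j) = T k + (\<Sum>j\<in>{k<..<N}. y ^ (j - k) * T j)"
    proof -
      have "{k..<N} = insert k {k<..<N}" using less.prems by auto
      then show ?thesis by simp
    qed
    moreover have "(\<Sum>j\<in>{k<..<N}. y ^ (j - k) * T j) \<in> P 1"
    proof (rule prime_set_sum[OF P(2)])
      fix j assume "j \<in> {k<..<N}"
      then have "y ^ (j - k) \<in> P 1" using P(2,4) by (simp add: prime_set_power)
      then show "y ^ (j - k) * T j \<in> P 1" using P(2) unfolding prime_set_def by blast
    qed
    ultimately have "T k \<in> P 1" using prime_set_add_cancel[OF P(2)] P(3) by auto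
    then have Tk: "(\<Sum>ms\<in>{ms. set ms \<subseteq> {..<N} \<and> length ms = length ys}.
        Poly_Mapping.single 0 (c (k # ms)) * power_prod ys ms) \<in> P (Suc 0)"
      by (simp add: T_def L_def)
    show ?case
    proof
      fix ms assume ms: "ms \<in> L"
      show "c (k # ms) = 0"
        by (rule Cons.IH[of "\<lambda>i. P (Suc i)" "\<lambda>ms. c (k # ms)"])
          (use Cons.prems(1,2) Tk ms in \<open>auto simp: L_def\<close>)
    qed
  qed
  then show ?case using Cons.prems(4,5) by (cases ms) (auto simp: L_def)
qed

definition exponents_le :: "nat \<Rightarrow> 'n rpoly \<Rightarrow> bool" where
  "exponents_le B p \<longleftrightarrow> (\<forall>m\<in>Poly_Mapping.keys p. \<forall>i. Poly_Mapping.lookup m i \<le> B)"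

lemma exponents_le_mult:
  assumes "exponents_le B p" "exponents_le C q"
  shows "exponents_le (B + C) (p * q)"
  unfolding exponents_le_def
proof (intro ballI allI)
  fix m i assume "m \<in> Poly_Mapping.keys (p * q)"
  then obtain a b where "a \<in> Poly_Mapping.keys p" "b \<in> Poly_Mapping.keys q" "m = a + b"
    using keys_mult[of p q] by auto
  then show "Poly_Mapping.lookup m i \<le> B + C"
    using assms by (auto simp: exponents_le_def lookup_add add_mono)
qed

lemma exponents_le_power: "exponents_le B p \<Longrightarrow> exponents_le (k * B) (p ^ k)"
proof (induction k)
  case 0
  show ?case by (simp add: exponents_le_def)
next
  case (Suc k)
  then show ?case using exponents_le_mult[of B p "k * B" "p ^ k"] by simp
qed

lemma exponents_le_mono: "exponents_le B p \<Longrightarrow> B \<le> C \<Longrightarrow> exponents_le C p"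
  unfolding exponents_le_def by (meson le_trans)

lemma exponents_le_exists: "\<exists>B. exponents_le B (p :: 'n::finite rpoly)"
proof -
  let ?S = "(\<lambda>(m, i). Poly_Mapping.lookup m i) ` (Poly_Mapping.keys p \<times> UNIV)"
  have "exponents_le (Max ?S) p" unfolding exponents_le_def
    by (intro ballI allI Max_ge) (auto intro!: image_eqI)
  then show ?thesis ..
qed

lemma exponents_le_power_prod:
  assumes "\<forall>y\<in>set ys. exponents_le D y" "set ms \<subseteq> {..<N}" "length ms = length ys"
  shows "exponents_le (length ys * (N * D)) (power_prod ys ms)"
  using assms(3,1,2)
proof (induction ms ys rule: list_induct2)
  case Nil
  show ?case by (simp add: exponents_le_def power_prod_def)
next
  case (Cons m ms y ys)
  have "exponents_le (N * D) (y ^ m)"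
    using Cons.prems exponents_le_power[of D y m] by (auto intro: exponents_le_mono)
  then have "exponents_le (N * D + length ys * (N * D)) (y ^ m * power_prod ys ms)"
    using Cons by (intro exponents_le_mult) auto
  then show ?case by (simp add: power_prod_def)
qed

lemma card_bounded_monomials:
  fixes B :: nat
  defines "M \<equiv> {m :: 'n::finite \<Rightarrow>\<^sub>0 nat. \<forall>i. Poly_Mapping.lookup m i \<le> B}"
  shows "finite M" "card M \<le> (B + 1) ^ CARD('n)"
proof -
  let ?F = "PiE (UNIV :: 'n set) (\<lambda>_. {..B})"
  have sub: "Poly_Mapping.lookup ` M \<subseteq> ?F" by (auto simp: M_def)
  have inj: "inj_on Poly_Mapping.lookup M"
    by (intro inj_onI) (simp add: Poly_Mapping.lookup_inject)
  have fin: "finite ?F" by (rule finite_PiE) simp_all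
  show "finite M" using inj_on_finite[OF inj sub fin] .
  have "card M \<le> card ?F" using card_inj_on_le[OF inj sub fin] .
  then show "card M \<le> (B + 1) ^ CARD('n)" by (simp add: card_PiE)
qed

text \<open>
  Exponents below \<open>N\<close> give \<open>N ^ length ys\<close> linearly independent products, all in the span of the
  monomials with exponents of order \<open>N\<close> in each of the variables.
\<close>

lemma prime_chain_powers_card:
  fixes P :: "nat \<Rightarrow> 'n::finite rpoly set"
  assumes "\<forall>i\<le>length ys. prime_set (P i)"
    and "\<forall>i<length ys. P i \<subseteq> P (Suc i) \<and> ys ! i \<in> P (Suc i) - P i"
    and D: "\<forall>y\<in>set ys. exponents_le D y"
  shows "N ^ length ys \<le> (length ys * (N * D) + 1) ^ CARD('n)"
proof -
  interpret V: vector_space "\<lambda>(c::real) (p::'n rpoly). Poly_Mapping.single 0 c * p"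
  proof
    fix a b :: real and x :: "'n rpoly"
    have "Poly_Mapping.single 0 (a * b) = Poly_Mapping.single 0 a * (Poly_Mapping.single 0 b :: 'n rpoly)"
      by (simp add: mult_single)
    then show "Poly_Mapping.single 0 a * (Poly_Mapping.single 0 b * x) = Poly_Mapping.single 0 (a * b) * x"
      by (simp only: mult.assoc)
  qed (simp_all add: distrib_left distrib_right single_add)
  let ?B = "length ys * (N * D)"
  let ?M = "{m :: 'n \<Rightarrow>\<^sub>0 nat. \<forall>i. Poly_Mapping.lookup m i \<le> ?B}"
  let ?T = "(\<lambda>m. Poly_Mapping.single m (1::real)) ` ?M"
  let ?L = "{ms. set ms \<subseteq> {..<N} \<and> length ms = length ys}"
  have finL: "finite ?L" by (rule finite_lists_length_eq) simp
  have 0: "0 \<in> P 0" using assms(1) by (auto simp: prime_set_def)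
  have indep: "c ms = 0" if "(\<Sum>ms\<in>?L. Poly_Mapping.single 0 (c ms) * power_prod ys ms) = 0" "ms \<in> ?L"
    for c :: "nat list \<Rightarrow> real" and ms
    using prime_chain_powers_independent[OF assms(1,2), where N = N and c = c and ms = ms] that 0 by simp
  have inj: "inj_on (power_prod ys) ?L"
  proof (rule inj_onI, rule ccontr)
    fix a b assume ab: "a \<in> ?L" "b \<in> ?L" "power_prod ys a = power_prod ys b" "a \<noteq> b"
    let ?c = "\<lambda>ms. if ms = a then 1 else if ms = b then -1 else (0::real)"
    have "(\<Sum>ms\<in>?L. Poly_Mapping.single 0 (?c ms) * power_prod ys ms)
        = (\<Sum>ms\<in>{a, b}. Poly_Mapping.single 0 (?c ms) * power_prod ys ms)"
      using ab finL by (intro sum.mono_neutral_right) auto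
    also have "\<dots> = 0" using ab by (simp add: single_uminus)
    finally have "?c a = 0" using indep[of ?c a] ab(1) by blast
    then show False by simp
  qed
  have ind: "V.independent (power_prod ys ` ?L)"
  proof (rule V.independent_if_scalars_zero)
    fix u v assume u: "(\<Sum>v\<in>power_prod ys ` ?L. Poly_Mapping.single 0 (u v) * v) = 0"
      and v: "v \<in> power_prod ys ` ?L"
    from v obtain ms where ms: "ms \<in> ?L" "v = power_prod ys ms" by blast
    have "(\<Sum>ms\<in>?L. Poly_Mapping.single 0 (u (power_prod ys ms)) * power_prod ys ms) = 0"
      using u by (subst (asm) sum.reindex[OF inj]) simp
    then show "u v = 0" using indep[of "\<lambda>ms. u (power_prod ys ms)" ms] ms by simp
  qed (use finL in simp)
  have span: "power_prod ys ` ?L \<subseteq> V.span ?T"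
  proof
    fix p assume "p \<in> power_prod ys ` ?L"
    then have p: "exponents_le ?B p" using exponents_le_power_prod D by blast
    have "Poly_Mapping.single 0 (Poly_Mapping.lookup p m) * Poly_Mapping.single m 1 \<in> V.span ?T"
      if "m \<in> Poly_Mapping.keys p" for m
      by (intro V.span_scale V.span_base) (use that p in \<open>auto simp: exponents_le_def\<close>)
    then have "(\<Sum>m\<in>Poly_Mapping.keys p. Poly_Mapping.single m (Poly_Mapping.lookup p m)) \<in> V.span ?T"
      by (intro V.span_sum) (simp add: mult_single)
    then show "p \<in> V.span ?T" by (simp add: poly_mapping_expand[symmetric])
  qed
  have fin: "finite ?T" using card_bounded_monomials(1) by (rule finite_imageI)
  have "N ^ length ys = card ?L" by (simp add: card_lists_length_eq)
  also have "\<dots> = card (power_prod ys ` ?L)" by (rule card_image[OF inj, symmetric])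
  also have "\<dots> \<le> card ?T" using V.independent_span_bound[OF fin ind span] by blast
  also have "\<dots> \<le> card ?M" by (rule card_image_le[OF card_bounded_monomials(1)])
  also have "\<dots> \<le> (?B + 1) ^ CARD('n)" by (rule card_bounded_monomials(2))
  finally show ?thesis .
qed

text \<open>
  The Krull dimension of the polynomial ring is at most the number of variables: a longer chain would
  give more independent products than there are monomials, as the number of products grows with a
  higher power of \<open>N\<close>.
\<close>

theorem prime_chain_length:
  fixes P :: "nat \<Rightarrow> 'n::finite rpoly set"
  assumes P: "\<forall>i\<le>n. prime_set (P i)" "\<forall>i<n. P i \<subset> P (Suc i)"
  shows "n \<le> CARD('n)"
proof (rule ccontr)
  let ?d = "CARD('n)"
  assume "\<not> n \<le> ?d"
  then have nd: "Suc ?d \<le> n" by simp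
  have "\<forall>i. \<exists>y. i < n \<longrightarrow> y \<in> P (Suc i) - P i" using P(2) by blast
  then obtain y where y: "\<And>i. i < n \<Longrightarrow> y i \<in> P (Suc i) - P i" by metis
  define ys where "ys = map y [0..<n]"
  have len: "length ys = n" by (simp add: ys_def)
  have "\<forall>q. \<exists>B. exponents_le B (q :: 'n rpoly)" using exponents_le_exists by blast
  then obtain b where b: "\<And>q :: 'n rpoly. exponents_le (b q) q" by metis
  define D where "D = Max (b ` set ys)"
  have D: "\<forall>q\<in>set ys. exponents_le D q"
    using b by (auto intro!: exponents_le_mono[OF b] Max_ge simp: D_def)
  \<comment> \<open>the number of monomials is at most \<open>K * N ^ ?d\<close>, which \<open>N ^ (?d + 1)\<close> exceeds as soon as \<open>N > K\<close>\<close>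
  define K where "K = (n * D + 1) ^ ?d"
  define N where "N = K + 1"
  have "N * N ^ ?d = N ^ Suc ?d" by simp
  also have "\<dots> \<le> N ^ n" using nd by (intro power_increasing) (auto simp: N_def)
  also have "\<dots> \<le> (n * (N * D) + 1) ^ ?d"
  proof -
    have "\<forall>i<n. P i \<subseteq> P (Suc i) \<and> ys ! i \<in> P (Suc i) - P i"
      using P(2) y by (auto simp: ys_def)
    then show ?thesis using prime_chain_powers_card[of ys P D N] P(1) D by (simp add: len)
  qed
  also have "\<dots> \<le> (N * (n * D + 1)) ^ ?d"
  proof (rule power_mono)
    show "n * (N * D) + 1 \<le> N * (n * D + 1)" by (simp add: N_def algebra_simps)
  qed simp
  also have "\<dots> = K * N ^ ?d" unfolding K_def power_mult_distrib by (rule mult.commute)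
  finally have "N \<le> K" by (simp add: N_def)
  then show False by (simp add: N_def)
qed

section \<open>Sets of codimension one in the zero set of an irreducible polynomial\<close>

lemma ring_of_type_algebra_simps [simp]:
  "carrier (ring_of_type_algebra :: 'a::comm_ring_1 ring) = UNIV"
  "(\<otimes>\<^bsub>(ring_of_type_algebra :: 'a ring)\<^esub>) = (*)"
  "(\<oplus>\<^bsub>(ring_of_type_algebra :: 'a ring)\<^esub>) = (+)"
  "\<one>\<^bsub>(ring_of_type_algebra :: 'a ring)\<^esub> = 1"
  "\<zero>\<^bsub>(ring_of_type_algebra :: 'a ring)\<^esub> = 0"
  by (simp_all add: ring_of_type_algebra_def)

lemma primeideal_imp_prime_set:
  fixes P :: "'a::comm_ring_1 set"
  assumes "primeideal P (ring_of_type_algebra :: 'a ring)"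
  shows "prime_set P"
proof -
  interpret primeideal P "ring_of_type_algebra :: 'a ring" by fact
  show ?thesis
    unfolding prime_set_def
  proof (intro conjI ballI allI)
    show "0 \<in> P"
      using additive_subgroup.zero_closed[OF ideal.axioms(1)[OF primeideal.axioms(1)[OF assms]]] by simp
    show "1 \<notin> P" using one_imp_carrier I_notcarr by auto
    show "a + b \<in> P" if "a \<in> P" "b \<in> P" for a b
      using additive_subgroup.a_closed[OF ideal.axioms(1)[OF primeideal.axioms(1)[OF assms]] that] by simp
    show "a * b \<in> P \<longleftrightarrow> a \<in> P \<or> b \<in> P" for a b
      using I_l_closed[of b a] I_r_closed[of a b] I_prime[of a b] by auto
  qed
qed

lemma poly_eval_uminus: "poly_eval (- p) x = - poly_eval p x"
  using poly_eval_add[of p "- p" x] by simp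

lemma ideal_vanishing_ideal:
  "ideal (vanishing_ideal S) (ring_of_type_algebra :: 'n::finite rpoly ring)"
proof -
  interpret R: cring "ring_of_type_algebra :: 'n rpoly ring" by (rule cring_from_type_algebra)
  have inv: "\<ominus>\<^bsub>(ring_of_type_algebra :: 'n rpoly ring)\<^esub> p = - p" for p
    by (rule R.minus_equality) simp_all
  show ?thesis
    by (rule idealI[OF R.ring_axioms])
      (unfold_locales, auto simp: vanishing_ideal_def poly_eval_add poly_eval_mult poly_eval_uminus
        inv[unfolded a_inv_def, simplified])
qed

text \<open>
  The correspondence between primes of the quotient and primes containing the ideal: chains are pulled
  back along the canonical projection, and remain strict because it is surjective.
\<close>

lemma prime_chain_of_quotient:
  fixes I :: "'a::comm_ring_1 set"
  assumes I: "ideal I (ring_of_type_algebra :: 'a ring)"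
    and P: "\<forall>i\<le>n. primeideal (P i) ((ring_of_type_algebra :: 'a ring) Quot I)" "\<forall>i<n. P i \<subset> P (Suc i)"
  shows "\<exists>Q. (\<forall>i\<le>n. prime_set (Q i) \<and> I \<subseteq> Q i) \<and> (\<forall>i<n. Q i \<subset> Q (Suc i))"
proof -
  let ?R = "ring_of_type_algebra :: 'a ring"
  interpret I: ideal I ?R by (rule I)
  interpret h: ring_hom_ring ?R "?R Quot I" "(+>\<^bsub>?R\<^esub>) I" by (rule I.rcos_ring_hom_ring)
  define Q where "Q i = {r \<in> carrier ?R. I +>\<^bsub>?R\<^esub> r \<in> P i}" for i
  have prime: "prime_set (Q i)" if "i \<le> n" for i
    unfolding Q_def
    by (rule primeideal_imp_prime_set, rule h.primeideal_vimage)
      (use that P(1) cring_from_type_algebra in auto)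
  have sub: "I \<subseteq> Q i" if "i \<le> n" for i
  proof
    fix r assume r: "r \<in> I"
    have "I +>\<^bsub>?R\<^esub> r = I" using I.a_rcos_const[OF r] .
    moreover have "I \<in> P i"
    proof -
      interpret Pi: primeideal "P i" "?R Quot I" using P(1) that by blast
      show ?thesis
        using additive_subgroup.zero_closed[OF ideal.axioms(1)[OF primeideal.axioms(1)[OF Pi.primeideal]]]
        by (simp add: FactRing_def)
    qed
    ultimately show "r \<in> Q i" by (simp add: Q_def)
  qed
  have strict: "Q i \<subset> Q (Suc i)" if i: "i < n" for i
  proof -
    obtain Y where Y: "Y \<in> P (Suc i)" "Y \<notin> P i" using P(2) i by blast
    interpret Pi: primeideal "P (Suc i)" "?R Quot I" using P(1) i by simp
    have "Y \<in> carrier (?R Quot I)" using Y(1) Pi.Icarr by blast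
    then obtain r where "Y = I +>\<^bsub>?R\<^esub> r" by (auto simp: FactRing_def A_RCOSETS_def')
    then have "r \<in> Q (Suc i)" "r \<notin> Q i" using Y by (auto simp: Q_def)
    moreover have "Q i \<subseteq> Q (Suc i)" using P(2) i by (auto simp: Q_def)
    ultimately show ?thesis by blast
  qed
  show ?thesis using prime sub strict by blast
qed

text \<open>
  Otherwise the primes over the vanishing ideal of \<open>S\<close>, which contain \<open>f\<close> and \<open>g\<close>, lie strictly above
  the prime \<open>(f)\<close>, which lies strictly above \<open>(0)\<close>. Chains of such primes are therefore shorter by two
  than the longest possible ones.
\<close>

lemma irreducible_divides_vanishing:
  fixes f :: "'n::finite rpoly"
  assumes f: "irreducible_poly f" and S: "S \<subseteq> zero_set f"
    and dim: "semialg_dim S = ereal (real CARD('n) - 1)"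
    and g: "\<And>x. x \<in> S \<Longrightarrow> poly_eval g x = 0"
  shows "f dvd g"
proof (rule ccontr)
  assume nd: "\<not> f dvd g"
  let ?R = "ring_of_type_algebra :: 'n rpoly ring"
  let ?I = "vanishing_ideal S"
  have fI: "f \<in> ?I" and gI: "g \<in> ?I"
    using S g by (auto simp: vanishing_ideal_def zero_set_def)
  have pf: "prime_elem f" using f by (rule irreducible_rpoly_imp_prime)
  have bound: "n + 2 \<le> CARD('n)"
    if P: "\<forall>i\<le>n. primeideal (P i) (?R Quot ?I)" "\<forall>i<n. P i \<subset> P (Suc i)" for n P
  proof -
    obtain Q where Q: "\<And>i. i \<le> n \<Longrightarrow> prime_set (Q i) \<and> ?I \<subseteq> Q i" "\<And>i. i < n \<Longrightarrow> Q i \<subset> Q (Suc i)"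
      using prime_chain_of_quotient[OF ideal_vanishing_ideal P] by blast
    \<comment> \<open>the chain prolonged downwards by \<open>(0)\<close> and \<open>(f)\<close>\<close>
    define C where "C i = (case i of 0 \<Rightarrow> {0} | Suc 0 \<Rightarrow> {h. f dvd h} | Suc (Suc k) \<Rightarrow> Q k)" for i
    have C: "C 0 = {0}" "C 1 = {h. f dvd h}" "C (Suc (Suc k)) = Q k" for k
      by (simp_all add: C_def)
    have "prime_set (C i)" if "i \<le> n + 2" for i
    proof -
      consider "i = 0" | "i = 1" | k where "i = Suc (Suc k)"
        by (metis One_nat_def not0_implies_Suc)
      then show ?thesis
      proof cases
        case 1
        then show ?thesis by (auto simp: C prime_set_def rpoly_mult_eq_0_iff)
      next
        case 2
        then show ?thesis using pf
          by (auto simp: C(2)[unfolded One_nat_def] prime_set_def comm_semiring_1_class.prime_elem_def)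
      next
        case 3
        then show ?thesis using Q(1) that by (simp add: C)
      qed
    qed
    moreover have "C i \<subset> C (Suc i)" if "i < n + 2" for i
    proof -
      consider "i = 0" | "i = 1" | k where "i = Suc (Suc k)"
        by (metis One_nat_def not0_implies_Suc)
      then show ?thesis
      proof cases
        case 1
        have "f \<noteq> 0" using pf by (simp add: comm_semiring_1_class.prime_elem_def)
        then show ?thesis using 1 C(1,2) by auto
      next
        case 2
        have "h \<in> Q 0" if "f dvd h" for h
          using that Q(1)[of 0] fI by (auto simp: dvd_def prime_set_def)
        moreover have "g \<in> Q 0" using Q(1)[of 0] gI by blast
        ultimately show ?thesis using 2 nd C(2) C(3)[of 0] by auto
      next
        case 3
        then show ?thesis using Q(2) that by (simp add: C)
      qed
    qed
    ultimately show ?thesis using prime_chain_length[of "n + 2" C] by blast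
  qed
  have "semialg_dim S \<le> ereal (real CARD('n) - 2)"
    unfolding semialg_dim_def krull_dim_def
  proof (rule Sup_least)
    fix e assume "e \<in> {ereal (real n) |n. \<exists>P. (\<forall>i\<le>n. primeideal (P i) (?R Quot ?I)) \<and> (\<forall>i<n. P i \<subset> P (Suc i))}"
    then obtain n P where e: "e = ereal (real n)" "\<forall>i\<le>n. primeideal (P i) (?R Quot ?I)" "\<forall>i<n. P i \<subset> P (Suc i)"
      by blast
    then show "e \<le> ereal (real CARD('n) - 2)" using bound[of n P] by simp
  qed
  then show False using dim by simp
qed

section \<open>Partial derivatives and changes of sign\<close>

text \<open>
  The partial derivative of \<open>f\<close> in the variable \<open>i\<close> is nonzero and of smaller degree in \<open>i\<close> than \<open>f\<close>,
  so \<open>f\<close> cannot divide it.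
\<close>

lemma derivative_rpoly_exists:
  fixes f :: "'n::finite rpoly"
  assumes "i \<in> vars f"
  shows "\<exists>D. \<not> f dvd D \<and> (\<forall>x. ((\<lambda>t. poly_eval f (\<chi> j. if j = i then t else x $ j))
    has_real_derivative poly_eval D x) (at (x $ i)))"
proof -
  define n where "n = Polynomial.degree (as_poly_in i f)"
  define c where "c k = poly.coeff (as_poly_in i f) k" for k
  define D where "D = (\<Sum>k<n. of_nat (Suc k) * c (Suc k) * rvar i ^ k)"
  have n: "n \<noteq> 0" using assms degree_as_poly_in_eq_0_iff[of i f] by (simp add: n_def)
  have "i \<notin> vars (of_nat (Suc k) * c (Suc k))" for k
  proof -
    have "vars (of_nat (Suc k) :: 'n rpoly) = {}"
      by (simp only: vars_def single_of_nat[symmetric]) (auto split: if_splits)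
    then show ?thesis
      using vars_mult[of "of_nat (Suc k)" "c (Suc k)"] vars_coeff_as_poly_in[of i f "Suc k"] by (auto simp: c_def)
  qed
  then have "as_poly_in i D = (\<Sum>k<n. Polynomial.monom (of_nat (Suc k) * c (Suc k)) k)"
    unfolding D_def as_poly_in_sum as_poly_in_mult[of i "of_nat _ * _"]
    by (simp add: as_poly_in_free as_poly_in_power monom_power Polynomial.smult_monom del: of_nat_Suc)
  then have coeff: "poly.coeff (as_poly_in i D) k = (if k < n then of_nat (Suc k) * c (Suc k) else 0)" for k
    by (simp add: coeff_sum del: of_nat_Suc)
  have fnz: "f \<noteq> 0" using assms by auto
  have "of_nat n * c n \<noteq> 0"
    using n fnz by (simp add: rpoly_mult_eq_0_iff c_def n_def as_poly_in_eq_0_iff)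
  moreover have "poly.coeff (as_poly_in i D) (n - 1) = of_nat n * c n"
    using n unfolding coeff by (cases n) (simp_all del: of_nat_Suc)
  ultimately have Dnz: "D \<noteq> 0" by auto
  have deg: "Polynomial.degree (as_poly_in i D) < n"
    using n by (intro degree_lessI) (auto simp: coeff)
  have "\<not> f dvd D"
  proof
    assume "f dvd D"
    then obtain u where u: "D = f * u" unfolding dvd_def by blast
    then have "u \<noteq> 0" using Dnz by auto
    then show False using deg degree_as_poly_in_mult[OF fnz, of u i] u by (simp add: n_def)
  qed
  moreover have "((\<lambda>t. poly_eval f (\<chi> j. if j = i then t else x $ j))
    has_real_derivative poly_eval D x) (at (x $ i))" for x
  proof -
    let ?a = "\<lambda>k. poly_eval (c k) x"
    have "((\<lambda>t. \<Sum>k\<le>n. ?a k * t ^ k) has_real_derivative (\<Sum>k\<le>n. ?a k * (real k * x $ i ^ (k - 1)))) (at (x $ i))"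
      by (auto intro!: derivative_eq_intros sum.cong)
    moreover have "(\<Sum>k\<le>n. ?a k * (real k * x $ i ^ (k - 1))) = poly_eval D x"
    proof -
      obtain m where m: "n = Suc m" using n not0_implies_Suc by blast
      have "(\<Sum>k\<le>n. ?a k * (real k * x $ i ^ (k - 1))) = (\<Sum>k\<le>m. ?a (Suc k) * (real (Suc k) * x $ i ^ k))"
        unfolding m by (subst sum.atMost_Suc_shift) simp
      also have "\<dots> = poly_eval D x"
        by (simp add: D_def m lessThan_Suc_atMost poly_eval_sum poly_eval_mult poly_eval_power ac_simps
          del: of_nat_Suc)
      finally show ?thesis .
    qed
    ultimately show ?thesis by (simp add: poly_eval_line c_def n_def)
  qed
  ultimately show ?thesis by blast
qed

lemma sign_change_near_regular_zero:
  fixes f D :: "'n::finite rpoly" and x :: "real ^ 'n"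
  assumes D: "((\<lambda>t. poly_eval f (\<chi> j. if j = i then t else x $ j)) has_real_derivative poly_eval D x) (at (x $ i))"
    and "poly_eval D x \<noteq> 0" "poly_eval f x = 0" "\<delta> > 0" "s \<noteq> 0"
  shows "\<exists>y\<in>ball x \<delta>. s * poly_eval f y > 0"
proof -
  let ?l = "\<lambda>t. (\<chi> j. if j = i then t else x $ j) :: real ^ 'n"
  have l0: "?l (x $ i) = x" by (simp add: vec_eq_iff)
  have dist: "dist x (?l t) = \<bar>t - x $ i\<bar>" for t
  proof -
    have "x - ?l t = (x $ i - t) *\<^sub>R axis i 1" by (simp add: vec_eq_iff axis_def)
    then show ?thesis by (simp add: dist_norm abs_minus_commute)
  qed
  have der: "((\<lambda>t. s * poly_eval f (?l t)) has_real_derivative s * poly_eval D x) (at (x $ i))"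
    using D by (rule DERIV_cmult)
  have "\<exists>t. \<bar>t - x $ i\<bar> < \<delta> \<and> s * poly_eval f (?l t) > 0"
  proof (cases "s * poly_eval D x > 0")
    case True
    from DERIV_pos_inc_right[OF der this] obtain d where d: "d > 0"
      "\<And>h. h > 0 \<Longrightarrow> h < d \<Longrightarrow> s * poly_eval f (?l (x $ i)) < s * poly_eval f (?l (x $ i + h))" by blast
    have "0 < s * poly_eval f (?l (x $ i + min d \<delta> / 2))"
      using d(2)[of "min d \<delta> / 2"] d(1) assms(3,4) unfolding l0 by simp
    then show ?thesis using d(1) assms(4) by (intro exI[of _ "x $ i + min d \<delta> / 2"]) auto
  next
    case False
    then have "s * poly_eval D x < 0" using assms(2,5) by (metis linorder_neqE_linordered_idom mult_eq_0_iff)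
    from DERIV_neg_dec_left[OF der this] obtain d where d: "d > 0"
      "\<And>h. h > 0 \<Longrightarrow> h < d \<Longrightarrow> s * poly_eval f (?l (x $ i)) < s * poly_eval f (?l (x $ i - h))" by blast
    have "0 < s * poly_eval f (?l (x $ i - min d \<delta> / 2))"
      using d(2)[of "min d \<delta> / 2"] d(1) assms(3,4) unfolding l0 by simp
    then show ?thesis using d(1) assms(4) by (intro exI[of _ "x $ i - min d \<delta> / 2"]) auto
  qed
  then show ?thesis using dist by (metis mem_ball)
qed

section \<open>Signs near a generic point of the zero set\<close>

lemma irreducible_power_decomposition:
  fixes f p :: "'n::finite rpoly"
  assumes f: "irreducible_poly f" and "p \<noteq> 0"
  shows "\<exists>k g. p = f ^ k * g \<and> \<not> f dvd g"
  using assms(2)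
proof (induction "deg_sum p" arbitrary: p rule: less_induct)
  case less
  show ?case
  proof (cases "f dvd p")
    case True
    then obtain q where q: "p = f * q" unfolding dvd_def by blast
    have nz: "f \<noteq> 0" "q \<noteq> 0" using q less.prems by auto
    have "\<not> f dvd 1" using f by (simp add: comm_semiring_1_class.irreducible_def)
    then have "deg_sum q < deg_sum p"
      using deg_sum_mult[OF nz] deg_sum_eq_0_iff[OF nz(1)] q by simp
    then obtain k g where "q = f ^ k * g" "\<not> f dvd g" using less.hyps nz(2) by blast
    then have "p = f ^ Suc k * g \<and> \<not> f dvd g" using q by (simp add: mult.assoc)
    then show ?thesis by blast
  next
    case False
    then have "p = f ^ 0 * p \<and> \<not> f dvd p" by simp
    then show ?thesis by blast
  qed
qed

lemma has_multiplicityI: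
  fixes f g :: "'n::finite rpoly"
  assumes "f \<noteq> 0" "k \<ge> 1" "\<not> f dvd g"
  shows "has_multiplicity f (f ^ k * g) k"
  unfolding has_multiplicity_def
proof (intro conjI notI)
  assume "f ^ (k + 1) dvd f ^ k * g"
  then obtain t where "f ^ k * g = f ^ k * (f * t)" unfolding dvd_def by (auto simp: ac_simps)
  moreover have "f ^ k \<noteq> 0" using assms(1) by (simp add: rpoly_power_eq_0_iff)
  ultimately have "g = f * t" using rpoly_mult_left_cancel by blast
  then show False using assms(3) by simp
qed (use assms in auto)

text \<open>
  If one of the polynomials vanished at each point of \<open>S\<close>, their product would vanish on \<open>S\<close> and be a
  multiple of the prime \<open>f\<close>.
\<close>

lemma generic_point:
  fixes f :: "'n::finite rpoly"
  assumes f: "irreducible_poly f" and S: "S \<subseteq> zero_set f"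
    and dim: "semialg_dim S = ereal (real CARD('n) - 1)"
    and T: "finite T" "\<And>g. g \<in> T \<Longrightarrow> \<not> f dvd g"
  shows "\<exists>x\<in>S. \<forall>g\<in>T. poly_eval g x \<noteq> 0"
proof (rule ccontr)
  assume *: "\<not> ?thesis"
  have pf: "prime_elem f" using f by (rule irreducible_rpoly_imp_prime)
  have "poly_eval (\<Prod>g\<in>T. g) x = 0" if "x \<in> S" for x
    using * that T(1) by (auto simp: poly_eval_prod)
  then have "f dvd (\<Prod>g\<in>T. g)" by (rule irreducible_divides_vanishing[OF f S dim])
  moreover have "\<not> f dvd (\<Prod>g\<in>T. g)"
    using T
  proof (induction T rule: finite_induct)
    case empty
    then show ?case using pf by (simp add: comm_semiring_1_class.prime_elem_def)
  next
    case (insert g T)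
    then have "\<not> f dvd g" "\<not> f dvd (\<Prod>g\<in>T. g)" by auto
    then show ?case using pf insert.hyps by (auto simp: comm_semiring_1_class.prime_elem_def)
  qed
  ultimately show False by blast
qed

text \<open>
  The point \<open>x\<close> is one where the \<open>g i\<close> and a partial derivative of \<open>f\<close> do not vanish. The factor \<open>s\<close>
  selects the side of the zero set on which \<open>y\<close> lies.
\<close>

lemma crossing_at_generic_point:
  fixes f :: "'n::finite rpoly" and g :: "nat \<Rightarrow> 'n rpoly"
  assumes f: "irreducible_poly f"
    and dim: "semialg_dim (zero_set f \<inter> ball b \<epsilon>) = ereal (real CARD('n) - 1)"
    and I: "finite I" "\<And>i. i \<in> I \<Longrightarrow> \<not> f dvd g i"
  shows "\<exists>x\<in>zero_set f \<inter> ball b \<epsilon>. (\<forall>i\<in>I. poly_eval (g i) x \<noteq> 0) \<and>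
    (\<forall>s. s \<noteq> 0 \<longrightarrow> (\<exists>y\<in>ball b \<epsilon>. s * poly_eval f y > 0 \<and>
      (\<forall>i\<in>I. poly_eval (g i) y * poly_eval (g i) x > 0)))"
proof -
  have "f \<noteq> 0" "\<not> f dvd 1" using f by (auto simp: comm_semiring_1_class.irreducible_def)
  then obtain v where v: "v \<in> vars f" using unit_iff_vars_empty by blast
  obtain D where D: "\<not> f dvd D" and der: "\<And>x. ((\<lambda>t. poly_eval f (\<chi> j. if j = v then t else x $ j))
      has_real_derivative poly_eval D x) (at (x $ v))"
    using derivative_rpoly_exists[OF v] by blast
  have "finite (insert D (g ` I))" "\<And>h. h \<in> insert D (g ` I) \<Longrightarrow> \<not> f dvd h"
    using I D by auto
  then obtain x where x: "x \<in> zero_set f \<inter> ball b \<epsilon>" "\<forall>h\<in>insert D (g ` I). poly_eval h x \<noteq> 0"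
    using generic_point[OF f Int_lower1 dim] by blast
  let ?U = "ball b \<epsilon> \<inter> (\<Inter>i\<in>I. {y. 0 < poly_eval (g i) y * poly_eval (g i) x})"
  have "open {y. 0 < poly_eval (g i) y * poly_eval (g i) x}" for i
    by (intro open_Collect_less continuous_intros continuous_poly_eval)
  then have "open ?U" using I(1) by (intro open_Int open_INT) auto
  moreover have "x \<in> ?U" using x by (auto simp: zero_less_mult_iff not_less order_le_less)
  ultimately obtain \<delta> where \<delta>: "0 < \<delta>" "ball x \<delta> \<subseteq> ?U" by (rule openE)
  have "\<exists>y\<in>ball b \<epsilon>. s * poly_eval f y > 0 \<and> (\<forall>i\<in>I. poly_eval (g i) y * poly_eval (g i) x > 0)"
    if s: "s \<noteq> 0" for s
  proof -
    have "poly_eval D x \<noteq> 0" "poly_eval f x = 0" using x by (auto simp: zero_set_def)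
    then obtain y where "y \<in> ball x \<delta>" "s * poly_eval f y > 0"
      using sign_change_near_regular_zero[OF der _ _ \<delta>(1) s] by blast
    then show ?thesis using \<delta>(2) by blast
  qed
  then show ?thesis using x by blast
qed

lemma bool_eval_cong:
  "(\<And>i. i \<in> bool_vars F \<Longrightarrow> v i = w i) \<Longrightarrow> bool_eval F v = bool_eval F w"
  by (induction F) auto

text \<open>
  At most one of the \<open>p i\<close>, namely \<open>p j\<close>, changes its sign near a generic zero \<open>x\<close> of \<open>f\<close>. Then the
  side of the zero set on which \<open>p j\<close> is positive satisfies the same conditions \<open>p i \<ge> 0\<close> as \<open>x\<close>,
  where \<open>p j\<close> is zero, and so belongs to \<open>A\<close> along with \<open>x\<close>. The index \<open>j\<close> may lie outside \<open>{1..m}\<close>;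
  this is the case that no \<open>p i\<close> is a multiple of \<open>f\<close>.
\<close>

lemma zero_set_not_cut_by_odd_factor:
  fixes f :: "'n::finite rpoly"
  assumes f: "irreducible_poly f"
    and p: "\<And>i. i \<in> {1..m} \<Longrightarrow> p i = f ^ k i * g i \<and> \<not> f dvd g i"
    and \<Phi>: "bool_vars \<Phi> \<subseteq> {1..m}" and A: "A = {x. bool_eval \<Phi> (\<lambda>i. poly_eval (p i) x \<ge> 0)}"
    and dim: "semialg_dim (zero_set f \<inter> ball b \<epsilon>) = ereal (real CARD('n) - 1)"
    and eq: "zero_set f \<inter> ball b \<epsilon> = A \<inter> ball b \<epsilon>"
  shows "\<not> (\<forall>i\<in>{1..m}. k i \<noteq> 0 \<longrightarrow> i = j \<and> odd (k i))"
proof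
  assume k: "\<forall>i\<in>{1..m}. k i \<noteq> 0 \<longrightarrow> i = j \<and> odd (k i)"
  obtain x where x: "x \<in> zero_set f \<inter> ball b \<epsilon>" "\<forall>i\<in>{1..m}. poly_eval (g i) x \<noteq> 0"
    and cross: "\<And>s. s \<noteq> 0 \<Longrightarrow> \<exists>y\<in>ball b \<epsilon>. s * poly_eval f y > 0 \<and>
      (\<forall>i\<in>{1..m}. poly_eval (g i) y * poly_eval (g i) x > 0)"
    using crossing_at_generic_point[OF f dim, of "{1..m}" g] p by blast
  \<comment> \<open>the side on which \<open>f ^ k * g j\<close> is positive for odd \<open>k\<close>\<close>
  define s :: real where "s = (if poly_eval (g j) x > 0 then 1 else - 1)"
  have "s \<noteq> 0" by (simp add: s_def)
  then obtain y where y: "y \<in> ball b \<epsilon>" "s * poly_eval f y > 0"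
    "\<forall>i\<in>{1..m}. poly_eval (g i) y * poly_eval (g i) x > 0"
    using cross by blast
  have "(poly_eval (p i) x \<ge> 0) = (poly_eval (p i) y \<ge> 0)" if i: "i \<in> {1..m}" for i
  proof (cases "k i = 0")
    case True
    then have "p i = g i" using p[OF i] by simp
    moreover have "poly_eval (g i) y * poly_eval (g i) x > 0" using y(3) i by blast
    ultimately show ?thesis by (auto simp: zero_less_mult_iff)
  next
    case False
    then have ij: "i = j" "odd (k i)" using k i by auto
    have "poly_eval (p i) x = 0"
      using p[OF i] False x(1) by (simp add: poly_eval_mult poly_eval_power zero_set_def)
    moreover have "poly_eval (p i) y > 0"
    proof (cases "poly_eval (g i) x > 0")
      case True
      then have "poly_eval f y > 0" "poly_eval (g i) y > 0"
        using y(2,3) i ij(1) by (auto simp: s_def zero_less_mult_iff)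
      then show ?thesis using p[OF i] by (simp add: poly_eval_mult poly_eval_power)
    next
      case False
      then have "poly_eval f y < 0" "poly_eval (g i) y < 0"
        using y(2,3) i ij(1) by (auto simp: s_def zero_less_mult_iff)
      then show ?thesis using p[OF i] ij(2)
        by (simp add: poly_eval_mult poly_eval_power mult_neg_neg)
    qed
    ultimately show ?thesis by simp
  qed
  then have "bool_eval \<Phi> (\<lambda>i. poly_eval (p i) x \<ge> 0) = bool_eval \<Phi> (\<lambda>i. poly_eval (p i) y \<ge> 0)"
    using \<Phi> by (intro bool_eval_cong) blast
  moreover have "x \<in> A" using x(1) eq by blast
  ultimately have "y \<in> A" by (simp add: A)
  then have "y \<in> zero_set f" using y(1) eq by blast
  then show False using y(2) by (simp add: zero_set_def)
qed

text \<open>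
  Even powers of \<open>f\<close> are positive on both sides of the zero set. If all exponents are even, then a point
  \<open>y\<close> on the side where \<open>f\<close> is positive and a point \<open>z\<close> on the other side satisfy the same conditions
  \<open>p i \<ge> 0\<close>.
\<close>

lemma nonneg_set_needs_odd_factor:
  fixes f :: "'n::finite rpoly"
  assumes f: "irreducible_poly f"
    and p: "\<And>i. i \<in> {1..m} \<Longrightarrow> p i = f ^ k i * g i \<and> \<not> f dvd g i"
    and \<Phi>: "bool_vars \<Phi> \<subseteq> {1..m}" and A: "A = {x. bool_eval \<Phi> (\<lambda>i. poly_eval (p i) x \<ge> 0)}"
    and dim: "semialg_dim (zero_set f \<inter> ball a \<epsilon>) = ereal (real CARD('n) - 1)"
    and eq: "nonneg_set f \<inter> ball a \<epsilon> = A \<inter> ball a \<epsilon>"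
  shows "\<exists>i\<in>{1..m}. odd (k i)"
proof (rule ccontr)
  assume "\<not> ?thesis"
  then have even: "\<And>i. i \<in> {1..m} \<Longrightarrow> even (k i)" by blast
  obtain x where x: "\<forall>i\<in>{1..m}. poly_eval (g i) x \<noteq> 0"
    and cross: "\<And>s. s \<noteq> 0 \<Longrightarrow> \<exists>y\<in>ball a \<epsilon>. s * poly_eval f y > 0 \<and>
      (\<forall>i\<in>{1..m}. poly_eval (g i) y * poly_eval (g i) x > 0)"
    using crossing_at_generic_point[OF f dim, of "{1..m}" g] p by blast
  obtain y where y: "y \<in> ball a \<epsilon>" "poly_eval f y > 0"
    "\<forall>i\<in>{1..m}. poly_eval (g i) y * poly_eval (g i) x > 0"
    using cross[of 1] by auto
  obtain z where z: "z \<in> ball a \<epsilon>" "poly_eval f z < 0"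
    "\<forall>i\<in>{1..m}. poly_eval (g i) z * poly_eval (g i) x > 0"
    using cross[of "-1"] by auto
  have sign: "(poly_eval (p i) w \<ge> 0) = (poly_eval (g i) x > 0)"
    if i: "i \<in> {1..m}" and w: "poly_eval f w \<noteq> 0" "poly_eval (g i) w * poly_eval (g i) x > 0" for i w
  proof -
    have "poly_eval f w ^ k i > 0" using even[OF i] w(1) by (simp add: zero_less_power_eq)
    then have "(poly_eval (p i) w \<ge> 0) = (poly_eval (g i) w \<ge> 0)"
      using p[OF i] by (simp add: poly_eval_mult poly_eval_power zero_le_mult_iff)
    then show ?thesis using w(2) by (auto simp: zero_less_mult_iff)
  qed
  have "(poly_eval (p i) y \<ge> 0) = (poly_eval (p i) z \<ge> 0)" if i: "i \<in> {1..m}" for i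
  proof -
    have "poly_eval (g i) y * poly_eval (g i) x > 0" "poly_eval (g i) z * poly_eval (g i) x > 0"
      using y(3) z(3) i by blast+
    then show ?thesis using sign[OF i, of y] sign[OF i, of z] y(2) z(2) by simp
  qed
  then have "bool_eval \<Phi> (\<lambda>i. poly_eval (p i) y \<ge> 0) = bool_eval \<Phi> (\<lambda>i. poly_eval (p i) z \<ge> 0)"
    using \<Phi> by (intro bool_eval_cong) blast
  then have "y \<in> A \<longleftrightarrow> z \<in> A" by (simp add: A)
  moreover have "y \<in> nonneg_set f" "z \<notin> nonneg_set f" using y(2) z(2) by (simp_all add: nonneg_set_def)
  then have "y \<in> A" "z \<notin> A" using y(1) z(1) eq by blast+
  ultimately show False by blast
qed

text \<open>
  The zero set has no interior, so its part in the ball consists of boundary points of \<open>A\<close>. Both sets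
  have the same vanishing ideal: a polynomial vanishing on the smaller one is a multiple of \<open>f\<close>.
\<close>

lemma frontier_dimension:
  fixes f :: "'n::finite rpoly"
  assumes f: "irreducible_poly f"
    and dim: "semialg_dim (zero_set f \<inter> ball b \<epsilon>) = ereal (real CARD('n) - 1)"
    and eq: "zero_set f \<inter> ball b \<epsilon> = A \<inter> ball b \<epsilon>"
  shows "semialg_dim (frontier A \<inter> zero_set f) = ereal (real CARD('n) - 1)"
proof -
  let ?S = "zero_set f \<inter> ball b \<epsilon>"
  have "f \<noteq> 0" using f by (auto simp: comm_semiring_1_class.irreducible_def)
  have sub: "?S \<subseteq> frontier A"
  proof
    fix x assume x: "x \<in> ?S"
    have "x \<notin> interior A"
    proof
      assume "x \<in> interior A"
      then have "open (interior A \<inter> ball b \<epsilon>)" "interior A \<inter> ball b \<epsilon> \<noteq> {}" using x by auto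
      then obtain z where "z \<in> interior A \<inter> ball b \<epsilon>" "poly_eval f z \<noteq> 0"
        using nonzero_on_open[OF _ _ \<open>f \<noteq> 0\<close>] by blast
      moreover from this have "z \<in> ?S" using eq interior_subset[of A] by blast
      ultimately show False by (simp add: zero_set_def)
    qed
    moreover have "x \<in> closure A" using x eq closure_subset by blast
    ultimately show "x \<in> frontier A" by (simp add: frontier_def)
  qed
  have "vanishing_ideal (frontier A \<inter> zero_set f) = vanishing_ideal ?S"
  proof (intro subset_antisym subsetI)
    fix g assume "g \<in> vanishing_ideal ?S"
    then have "f dvd g"
      by (intro irreducible_divides_vanishing[OF f _ dim]) (auto simp: vanishing_ideal_def)
    then show "g \<in> vanishing_ideal (frontier A \<inter> zero_set f)"
      by (auto simp: vanishing_ideal_def zero_set_def poly_eval_mult dvd_def)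
  qed (use sub in \<open>auto simp: vanishing_ideal_def\<close>)
  then show ?thesis using dim by (simp add: semialg_dim_def)
qed

theorem corollary1p2:
  fixes m :: nat
    and p :: "nat \<Rightarrow> 'n::finite rpoly"
    and \<Phi> :: bool_formula
    and A :: "(real ^ 'n) set"
    and f :: "'n rpoly"
  assumes "\<And>i. i \<in> {1..m} \<Longrightarrow> p i \<noteq> 0"
    and "bool_vars \<Phi> \<subseteq> {1..m}"
    and "A = {x. bool_eval \<Phi> (\<lambda>i. poly_eval (p i) x \<ge> 0)}"
    and "irreducible_poly f"
  shows
    "((\<exists>b\<in>zero_set f. \<exists>\<epsilon>>0.
          semialg_dim (zero_set f \<inter> ball b \<epsilon>) = ereal (real CARD('n) - 1) \<and>
          zero_set f \<inter> ball b \<epsilon> = A \<inter> ball b \<epsilon>)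
      \<longrightarrow>
        semialg_dim (frontier A \<inter> zero_set f) = ereal (real CARD('n) - 1) \<and>
        ((\<exists>i\<in>{1..m}. \<exists>j\<in>{1..m}. i \<noteq> j \<and> f dvd p i \<and> f dvd p j) \<or>
         (\<exists>i\<in>{1..m}. even_multiplicity_factor f (p i))))
     \<and>
     ((\<exists>a b. \<exists>\<epsilon>>0.
          semialg_dim (zero_set f \<inter> ball a \<epsilon>) = ereal (real CARD('n) - 1) \<and>
          nonneg_set f \<inter> ball a \<epsilon> = A \<inter> ball a \<epsilon> \<and>
          semialg_dim (zero_set f \<inter> ball b \<epsilon>) = ereal (real CARD('n) - 1) \<and>
          zero_set f \<inter> ball b \<epsilon> = A \<inter> ball b \<epsilon>)
      \<longrightarrow>
        (\<exists>i\<in>{1..m}. \<exists>j\<in>{1..m}. i \<noteq> j \<and> f dvd p i \<and> odd_multiplicity_factor f (p j)))"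
proof -
  note f = \<open>irreducible_poly f\<close>
  have f0: "f \<noteq> 0" using f by (auto simp: comm_semiring_1_class.irreducible_def)
  have "\<forall>i. \<exists>k g. i \<in> {1..m} \<longrightarrow> p i = f ^ k * g \<and> \<not> f dvd g"
    using irreducible_power_decomposition[OF f] assms(1) by blast
  then obtain k g where p: "\<And>i. i \<in> {1..m} \<Longrightarrow> p i = f ^ k i * g i \<and> \<not> f dvd g i" by metis
  have dvd: "f dvd p i" if "i \<in> {1..m}" "k i \<noteq> 0" for i
    using p[OF that(1)] that(2) by (metis dvd_mult2 dvd_power gr0I)
  have mult: "has_multiplicity f (p i) (k i)" if "i \<in> {1..m}" "k i \<noteq> 0" for i
    using has_multiplicityI[OF f0, of "k i" "g i"] p[OF that(1)] that(2) by simp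
  note cut = zero_set_not_cut_by_odd_factor[OF f p assms(2,3)]
  show ?thesis
  proof (intro conjI impI)
    assume "\<exists>b\<in>zero_set f. \<exists>\<epsilon>>0. semialg_dim (zero_set f \<inter> ball b \<epsilon>) = ereal (real CARD('n) - 1) \<and>
      zero_set f \<inter> ball b \<epsilon> = A \<inter> ball b \<epsilon>"
    then obtain b \<epsilon> where b: "semialg_dim (zero_set f \<inter> ball b \<epsilon>) = ereal (real CARD('n) - 1)"
      "zero_set f \<inter> ball b \<epsilon> = A \<inter> ball b \<epsilon>" by blast
    show "semialg_dim (frontier A \<inter> zero_set f) = ereal (real CARD('n) - 1)"
      using frontier_dimension[OF f b] .
    \<comment> \<open>no \<open>i \<in> {1..m}\<close> equals \<open>0\<close>, so the exponents cannot all vanish\<close>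
    obtain i where i: "i \<in> {1..m}" "k i \<noteq> 0" using cut[OF _ b, of 0] by blast
    obtain i' where "i' \<in> {1..m}" "k i' \<noteq> 0" "i' \<noteq> i \<or> even (k i')" using cut[OF _ b, of i] by blast
    then show "(\<exists>i\<in>{1..m}. \<exists>j\<in>{1..m}. i \<noteq> j \<and> f dvd p i \<and> f dvd p j) \<or>
      (\<exists>i\<in>{1..m}. even_multiplicity_factor f (p i))"
      using i dvd mult unfolding even_multiplicity_factor_def by blast
  next
    assume "\<exists>a b. \<exists>\<epsilon>>0. semialg_dim (zero_set f \<inter> ball a \<epsilon>) = ereal (real CARD('n) - 1) \<and>
      nonneg_set f \<inter> ball a \<epsilon> = A \<inter> ball a \<epsilon> \<and>
      semialg_dim (zero_set f \<inter> ball b \<epsilon>) = ereal (real CARD('n) - 1) \<and>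
      zero_set f \<inter> ball b \<epsilon> = A \<inter> ball b \<epsilon>"
    then obtain a b \<epsilon> where a: "semialg_dim (zero_set f \<inter> ball a \<epsilon>) = ereal (real CARD('n) - 1)"
      "nonneg_set f \<inter> ball a \<epsilon> = A \<inter> ball a \<epsilon>"
      and b: "semialg_dim (zero_set f \<inter> ball b \<epsilon>) = ereal (real CARD('n) - 1)"
      "zero_set f \<inter> ball b \<epsilon> = A \<inter> ball b \<epsilon>" by blast
    obtain j where j: "j \<in> {1..m}" "odd (k j)"
      using nonneg_set_needs_odd_factor[OF f p assms(2,3) a] by blast
    then have odd: "odd_multiplicity_factor f (p j)"
      using mult[OF j(1)] unfolding odd_multiplicity_factor_def by (metis even_zero)
    obtain i where "i \<in> {1..m}" "k i \<noteq> 0" "i \<noteq> j"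
      using cut[OF _ b, of j] j by blast
    then show "\<exists>i\<in>{1..m}. \<exists>j\<in>{1..m}. i \<noteq> j \<and> f dvd p i \<and> odd_multiplicity_factor f (p j)"
      using dvd odd j(1) by blast
  qed
qed

end
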